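(* Let $\mathcal{H}$ be a complex Hilbert space, let $T$ be a bounded linear operator on $\mathcal{H}$, and suppose that $\mathcal{N}(T^* )\subseteq\mathcal{N}(T)$. If $T$ is semi-hyponormal, then the mean transform $\widehat{T}$ is also semi-hyponormal. Moreover, in this case the sequence of mean iterates $(\widehat{T}^{(n)})_{n\in\mathbb{N}}$ converges in the strong operator topology to a normal bounded linear operator $L$ on $\mathcal{H}$, and $$\ell(T)=\|L\|=\|\widehat{T}^{(n)}\|\quad\text{for all } n\in\mathbb{N}.$$
   Context: Here $\mathbb{N}=\{0,1,2,\dots\}$ and $\mathcal{N}(\cdot)$ denotes the null space. For a bounded operator $T$, $|T|:=(T^*T)^{1/2}$, and the canonical polar decomposition is $T=V|T|$ where $V$ is the partial isometry with $\mathcal{N}(V)=\mathcal{N}(T)$. The mean transform of $T$ is $\widehat{T}:=\frac12(V|T|+|T|V)$, where $T=V|T|$ is the canonical polar decomposition. Its iterates are $\widehat{T}^{(0)}:=T$ and $\widehat{T}^{(n+1)}:=\widehat{\widehat{T}^{(n)}}$, i.e. the mean transform of $\widehat{T}^{(n)}$. The sequence $(\|\widehat{T}^{(n)}\|)_{n\in\mathbb{N}}$ is non-increasing, and the mean limit of $T$ is $\ell(T):=\lim_{n\to\infty}\|\widehat{T}^{(n)}\|=\inf_{n}\|\widehat{T}^{(n)}\|$. An operator $T$ is semi-hyponormal if $(T^*T)^{1/2}\geq (TT^* )^{1/2}$. *)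

theory Defs
  imports "HOL-Analysis.Analysis" "HOL-Library.Nonpos_Ints"
begin

text \<open>
  Complex Hilbert spaces, built on top of the real inner product structure of the library: the
  real scalar product is the real part of the complex one, so that norm, metric and completeness
  are the library's. The complex inner product is linear in its first argument.
\<close>

class complex_hilbert_space = real_inner + complete_space +
  fixes scaleC :: "complex \<Rightarrow> 'a \<Rightarrow> 'a" (infixr "*\<^sub>C" 75)
    and cinner :: "'a \<Rightarrow> 'a \<Rightarrow> complex"
  assumes scaleC_add_right: "c *\<^sub>C (x + y) = c *\<^sub>C x + c *\<^sub>C y"
    and scaleC_add_left: "(c + d) *\<^sub>C x = c *\<^sub>C x + d *\<^sub>C x"
    and scaleC_scaleC: "c *\<^sub>C d *\<^sub>C x = (c * d) *\<^sub>C x"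
    and scaleC_of_real: "complex_of_real r *\<^sub>C x = r *\<^sub>R x"
    and cinner_commute: "cinner x y = cnj (cinner y x)"
    and cinner_add_left: "cinner (x + y) z = cinner x z + cinner y z"
    and cinner_scaleC_left: "cinner (c *\<^sub>C x) y = c * cinner x y"
    and Re_cinner: "Re (cinner x y) = inner x y"
begin

subclass banach ..

end

instantiation complex :: complex_hilbert_space
begin

definition scaleC_complex :: "complex \<Rightarrow> complex \<Rightarrow> complex"
  where "scaleC_complex c x = c * x"

definition cinner_complex :: "complex \<Rightarrow> complex \<Rightarrow> complex"
  where "cinner_complex x y = x * cnj y"

instance
  by standard
    (auto simp: scaleC_complex_def cinner_complex_def inner_complex_def scaleR_conv_of_real
      algebra_simps)

end

definition bounded_clinear :: "('a::complex_hilbert_space \<Rightarrow> 'a) \<Rightarrow> bool"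
  where "bounded_clinear T \<longleftrightarrow> bounded_linear T \<and> (\<forall>c x. T (c *\<^sub>C x) = c *\<^sub>C T x)"

definition null_space :: "('a::complex_hilbert_space \<Rightarrow> 'a) \<Rightarrow> 'a set"
  where "null_space T = {x. T x = 0}"

text \<open>
  The definite descriptions below denote uniquely determined operators for bounded complex linear
  \<open>T\<close> and, in \<open>op_sqrt\<close>, positive bounded \<open>A\<close>; outside these cases the values are unspecified.
\<close>

definition cadjoint :: "('a::complex_hilbert_space \<Rightarrow> 'a) \<Rightarrow> 'a \<Rightarrow> 'a"
  where "cadjoint T = (THE S. bounded_clinear S \<and> (\<forall>x y. cinner (T x) y = cinner x (S y)))"

text \<open>The Loewner order: the quadratic form of \<open>B - A\<close> takes only nonnegative real values.\<close>

definition op_le :: "('a::complex_hilbert_space \<Rightarrow> 'a) \<Rightarrow> ('a \<Rightarrow> 'a) \<Rightarrow> bool"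
  where "op_le A B \<longleftrightarrow> (\<forall>x. cinner (B x - A x) x \<in> \<real>\<^sub>\<ge>\<^sub>0)"

definition op_sqrt :: "('a::complex_hilbert_space \<Rightarrow> 'a) \<Rightarrow> 'a \<Rightarrow> 'a"
  where "op_sqrt A = (THE R. bounded_clinear R \<and> op_le (\<lambda>x. 0) R \<and> R \<circ> R = A)"

definition op_abs :: "('a::complex_hilbert_space \<Rightarrow> 'a) \<Rightarrow> 'a \<Rightarrow> 'a"
  where "op_abs T = op_sqrt (cadjoint T \<circ> T)"

text \<open>A partial isometry is isometric on the orthogonal complement of its null space.\<close>

definition partial_isometry :: "('a::complex_hilbert_space \<Rightarrow> 'a) \<Rightarrow> bool"
  where "partial_isometry V \<longleftrightarrow> bounded_clinear V \<and>
    (\<forall>x. (\<forall>y \<in> null_space V. cinner x y = 0) \<longrightarrow> norm (V x) = norm x)"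

definition polar_isometry :: "('a::complex_hilbert_space \<Rightarrow> 'a) \<Rightarrow> 'a \<Rightarrow> 'a"
  where "polar_isometry T =
    (THE V. partial_isometry V \<and> null_space V = null_space T \<and> T = V \<circ> op_abs T)"

definition mean_transform :: "('a::complex_hilbert_space \<Rightarrow> 'a) \<Rightarrow> 'a \<Rightarrow> 'a"
  where "mean_transform T =
    (\<lambda>x. (1/2) *\<^sub>R (polar_isometry T (op_abs T x) + op_abs T (polar_isometry T x)))"

definition mean_iterate :: "nat \<Rightarrow> ('a::complex_hilbert_space \<Rightarrow> 'a) \<Rightarrow> 'a \<Rightarrow> 'a"
  where "mean_iterate n T = (mean_transform ^^ n) T"

definition mean_limit :: "('a::complex_hilbert_space \<Rightarrow> 'a) \<Rightarrow> real"
  where "mean_limit T = lim (\<lambda>n. onorm (mean_iterate n T))"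

definition semi_hyponormal :: "('a::complex_hilbert_space \<Rightarrow> 'a) \<Rightarrow> bool"
  where "semi_hyponormal T \<longleftrightarrow> bounded_clinear T \<and>
    op_le (op_sqrt (T \<circ> cadjoint T)) (op_sqrt (cadjoint T \<circ> T))"

definition normal_op :: "('a::complex_hilbert_space \<Rightarrow> 'a) \<Rightarrow> bool"
  where "normal_op T \<longleftrightarrow> bounded_clinear T \<and> cadjoint T \<circ> T = T \<circ> cadjoint T"

definition sot_tendsto ::
    "(nat \<Rightarrow> 'a::complex_hilbert_space \<Rightarrow> 'a) \<Rightarrow> ('a \<Rightarrow> 'a) \<Rightarrow> bool"
  where "sot_tendsto S L \<longleftrightarrow> (\<forall>x. (\<lambda>n. S n x) \<longlonglongrightarrow> L x)"

end

theory Submission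
  imports Defs
begin

text \<open>
  Let \<open>T = V A\<close> be the canonical polar decomposition. Semi-hyponormality says \<open>V A V\<^sup>* \<le> A\<close>,
  so \<open>\<N>(T) \<subseteq> \<N>(T\<^sup>*)\<close>; with the assumption on null spaces the two are equal and \<open>V\<close> is a normal
  partial isometry. The mean transform is then \<open>V A\<^sub>1\<close> with \<open>A\<^sub>1 = (A + V\<^sup>* A V) / 2\<close>, which is again
  a canonical polar decomposition, and \<open>V A\<^sub>1 V\<^sup>* \<le> A\<^sub>1\<close>. Hence the iterates are \<open>V A\<^sub>n\<close>, where
  \<open>A\<^sub>n\<close> increases because \<open>A\<^sub>n \<le> V\<^sup>* A\<^sub>n V\<close> and stays bounded by \<open>\<parallel>A\<parallel>\<close>. The strong limit \<open>C\<close>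
  satisfies \<open>C = V\<^sup>* C V\<close>, so it commutes with \<open>V\<close> and \<open>V C\<close> is normal; all norms agree because
  \<open>A \<le> A\<^sub>n \<le> C\<close> and \<open>\<parallel>C\<parallel> \<le> \<parallel>A\<parallel>\<close>.
\<close>

section \<open>Orthogonal projection and Riesz representation\<close>

text \<open>A minimizing sequence is Cauchy by the parallelogram law, since the midpoint of two of
  its terms lies in \<open>S\<close> and so has distance at least \<open>d\<close> from
  \<open>x\<close>.\<close>

lemma exists_closest_in_subspace:
  fixes S :: "'a::{real_inner,complete_space} set"
  assumes "subspace S" "closed S"
  obtains p where "p \<in> S" "\<And>q. q \<in> S \<Longrightarrow> norm (x - p) \<le> norm (x - q)"
proof -
  define d where "d = infdist x S"
  have ne: "S \<noteq> {}" using assms(1) subspace_0 by blast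
  have d0: "0 \<le> d" by (simp add: d_def infdist_nonneg)
  have dle: "d \<le> norm (x - q)" if "q \<in> S" for q
    using infdist_le[OF that, of x] by (simp add: d_def dist_norm)
  have "\<exists>q\<in>S. norm (x - q) < d + inverse (real (Suc n))" for n
    using cInf_lessD[of "dist x ` S" "d + inverse (real (Suc n))"] ne
    by (auto simp: d_def infdist_notempty dist_norm simp del: of_nat_Suc)
  then obtain q where qS: "\<And>n. q n \<in> S" and q: "\<And>n. norm (x - q n) < d + inverse (real (Suc n))"
    by metis
  have "(\<lambda>n. norm (x - q n)) \<longlonglongrightarrow> d"
  proof (rule tendsto_sandwich)
    show "\<forall>\<^sub>F n in sequentially. d \<le> norm (x - q n)" using dle qS by auto
    show "\<forall>\<^sub>F n in sequentially. norm (x - q n) \<le> d + inverse (real (Suc n))"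
      using q less_imp_le by (simp add: less_imp_le)
    show "(\<lambda>n. d + inverse (real (Suc n))) \<longlonglongrightarrow> d"
      using tendsto_add[OF tendsto_const LIMSEQ_inverse_real_of_nat, of d] by simp
  qed simp
  then have lim: "(\<lambda>n. (norm (x - q n))\<^sup>2) \<longlonglongrightarrow> d\<^sup>2"
    by (intro tendsto_intros)
  have par: "(norm (q m - q n))\<^sup>2 \<le> 2 * ((norm (x - q m))\<^sup>2 - d\<^sup>2) + 2 * ((norm (x - q n))\<^sup>2 - d\<^sup>2)" for m n
  proof -
    define h where "h = (1/2) *\<^sub>R (q m + q n)"
    have "h \<in> S" using assms(1) qS by (simp add: h_def subspace_add subspace_scale)
    then have "d\<^sup>2 \<le> (norm (x - h))\<^sup>2" using dle d0 by (simp add: power_mono)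
    moreover have "(norm (q m - q n))\<^sup>2 =
        2 * (norm (x - q m))\<^sup>2 + 2 * (norm (x - q n))\<^sup>2 - 4 * (norm (x - h))\<^sup>2"
      unfolding h_def power2_norm_eq_inner
      by (simp add: inner_diff_left inner_diff_right inner_add_left inner_add_right
          inner_commute field_simps)
    ultimately show ?thesis by argo
  qed
  have "Cauchy q"
  proof (rule CauchyI)
    fix e :: real assume e: "0 < e"
    \<comment> \<open>Each of the two terms on the right of \<open>par\<close> then contributes less
      than half of the square of \<open>e\<close>.\<close>
    then have "\<forall>\<^sub>F n in sequentially. (norm (x - q n))\<^sup>2 < d\<^sup>2 + e\<^sup>2 / 4"
      by (intro order_tendstoD(2)[OF lim]) auto
    then obtain N where N: "\<And>n. n \<ge> N \<Longrightarrow> (norm (x - q n))\<^sup>2 < d\<^sup>2 + e\<^sup>2 / 4"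
      by (auto simp: eventually_sequentially)
    have "norm (q m - q n) < e" if "m \<ge> N" "n \<ge> N" for m n
    proof -
      have "(norm (q m - q n))\<^sup>2 < e\<^sup>2"
        using par[of m n] N[OF that(1)] N[OF that(2)] by argo
      then show ?thesis using e by (simp add: power_less_imp_less_base)
    qed
    then show "\<exists>M. \<forall>m\<ge>M. \<forall>n\<ge>M. norm (q m - q n) < e" by blast
  qed
  then obtain p where p: "q \<longlonglongrightarrow> p"
    using Cauchy_convergent_iff convergentD by blast
  have "p \<in> S" using assms(2) qS p closed_sequentially by blast
  moreover have "norm (x - p) = d"
    using tendsto_norm[OF tendsto_diff[OF tendsto_const p, of x]]
      \<open>(\<lambda>n. norm (x - q n)) \<longlonglongrightarrow> d\<close> LIMSEQ_unique by blast
  ultimately show thesis using that dle by metis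
qed

lemma subspace_orthogonal_decomposition:
  fixes S :: "'a::{real_inner,complete_space} set"
  assumes "subspace S" "closed S"
  obtains p r where "x = p + r" "p \<in> S" "\<And>q. q \<in> S \<Longrightarrow> inner r q = 0"
proof -
  obtain p where p: "p \<in> S" and min: "\<And>q. q \<in> S \<Longrightarrow> norm (x - p) \<le> norm (x - q)"
    using exists_closest_in_subspace[OF assms] by blast
  define r where "r = x - p"
  have "inner r q = 0" if q: "q \<in> S" for q
  proof (rule ccontr)
    assume ne: "inner r q \<noteq> 0"
    then have q0: "inner q q > 0" by auto
    \<comment> \<open>This \<open>t\<close> minimizes the norm of \<open>r - t *\<^sub>R q\<close>,
      so a nonzero inner product would give a point of \<open>S\<close> closer to \<open>x\<close>
      than \<open>p\<close>.\<close>
    define t where "t = inner r q / inner q q"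
    have "p + t *\<^sub>R q \<in> S" using assms(1) p q by (simp add: subspace_add subspace_scale)
    then have "norm r \<le> norm (r - t *\<^sub>R q)" using min by (simp add: r_def algebra_simps)
    then have "inner r r \<le> inner (r - t *\<^sub>R q) (r - t *\<^sub>R q)"
      by (simp add: norm_eq_sqrt_inner)
    also have "\<dots> = inner r r - (inner r q)\<^sup>2 / inner q q"
      using q0 by (simp add: t_def inner_diff_left inner_diff_right inner_commute
          power2_eq_square field_simps)
    finally have "(inner r q)\<^sup>2 / inner q q \<le> 0" by simp
    moreover have "(inner r q)\<^sup>2 / inner q q > 0" using ne q0 by simp
    ultimately show False by simp
  qed
  then show thesis using that[of p r] p by (simp add: r_def)
qed

lemma subspace_closure:
  fixes S :: "'a::real_normed_vector set"
  assumes "subspace S"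
  shows "subspace (closure S)"
proof (rule subspaceI)
  show "0 \<in> closure S" using closure_subset subspace_0[OF assms] by blast
  fix x y r assume x: "x \<in> closure S"
  then obtain u where u: "\<And>n. u n \<in> S" "u \<longlonglongrightarrow> x" by (auto simp: closure_sequential)
  show "r *\<^sub>R x \<in> closure S"
    using u subspace_scale[OF assms] tendsto_scaleR[OF tendsto_const u(2), of r]
    unfolding closure_sequential by (intro exI[of _ "\<lambda>n. r *\<^sub>R u n"]) auto
  assume "y \<in> closure S"
  then obtain w where w: "\<And>n. w n \<in> S" "w \<longlonglongrightarrow> y" by (auto simp: closure_sequential)
  show "x + y \<in> closure S"
    using u w subspace_add[OF assms] tendsto_add[OF u(2) w(2)]
    unfolding closure_sequential by (intro exI[of _ "\<lambda>n. u n + w n"]) auto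
qed

lemma riesz_representation:
  fixes f :: "'a::{real_inner,complete_space} \<Rightarrow> real"
  assumes "bounded_linear f"
  obtains z where "\<And>x. f x = inner x z"
proof (cases "\<forall>x. f x = 0")
  case True
  then show ?thesis using that[of 0] by simp
next
  case False
  interpret f: bounded_linear f by fact
  obtain u where u: "f u \<noteq> 0" using False by blast
  let ?S = "{x. f x = 0}"
  have "subspace ?S" by (auto simp: subspace_def f.add f.scale)
  moreover have "closed ?S"
    by (intro closed_Collect_eq continuous_intros linear_continuous_on assms)
  ultimately obtain p r where pr: "u = p + r" "f p = 0" and r: "\<And>q. f q = 0 \<Longrightarrow> inner r q = 0"
    using subspace_orthogonal_decomposition[of ?S u] by auto
  have fr: "f r \<noteq> 0" using u pr by (simp add: f.add)
  then have r0: "inner r r \<noteq> 0" using f.zero by auto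
  \<comment> \<open>The kernel of \<open>f\<close> has codimension one, so the vector
    \<open>r\<close> orthogonal to it determines \<open>f\<close> up to a factor.\<close>
  have "f x = inner x ((f r / inner r r) *\<^sub>R r)" for x
  proof -
    have "f (x - (f x / f r) *\<^sub>R r) = 0" using fr by (simp add: f.diff f.scale)
    then have "inner r (x - (f x / f r) *\<^sub>R r) = 0" by (rule r)
    then have "inner r x = (f x / f r) * inner r r" by (simp add: inner_diff_right)
    then show ?thesis using fr r0 by (simp add: inner_commute)
  qed
  then show ?thesis using that by blast
qed

section \<open>Bounded complex linear operators and adjoints\<close>

lemma bounded_clinear_bounded_linear: "bounded_clinear T \<Longrightarrow> bounded_linear T"
  and bounded_clinear_scaleC: "bounded_clinear T \<Longrightarrow> T (c *\<^sub>C x) = c *\<^sub>C T x"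
  by (auto simp: bounded_clinear_def)

lemmas bounded_clinear_simps =
  linear_simps[OF bounded_clinear_bounded_linear]

lemma scaleC_minus_right: "c *\<^sub>C (- x) = - (c *\<^sub>C x :: 'a::complex_hilbert_space)"
proof -
  have "c *\<^sub>C (- x) = c *\<^sub>C (complex_of_real (-1) *\<^sub>C x)" by (simp only: scaleC_of_real) simp
  also have "\<dots> = complex_of_real (-1) *\<^sub>C (c *\<^sub>C x)" by (simp only: scaleC_scaleC mult.commute)
  finally show ?thesis by (simp only: scaleC_of_real) simp
qed

lemma scaleC_diff_right: "c *\<^sub>C (x - y) = c *\<^sub>C x - (c *\<^sub>C y :: 'a::complex_hilbert_space)"
  using scaleC_add_right[of c x "- y"] by (simp add: scaleC_minus_right)

lemma scaleC_scaleR: "c *\<^sub>C (r *\<^sub>R x) = r *\<^sub>R (c *\<^sub>C x :: 'a::complex_hilbert_space)"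
  by (metis scaleC_of_real scaleC_scaleC mult.commute)

lemma scaleC_zero_right: "c *\<^sub>C 0 = (0 :: 'a::complex_hilbert_space)"
  using scaleC_scaleR[of c 0 "0::'a"] by simp

lemma inner_scaleC_left:
  "inner (c *\<^sub>C x) y = inner x (cnj c *\<^sub>C (y :: 'a::complex_hilbert_space))"
proof -
  have "cinner x (cnj c *\<^sub>C y) = c * cinner x y"
    by (metis cinner_commute cinner_scaleC_left complex_cnj_cnj complex_cnj_mult)
  then show ?thesis by (metis Re_cinner cinner_scaleC_left)
qed

text \<open>Recovers the complex inner product from the real one, so that the later arguments can be
  carried out with \<open>inner\<close> alone.\<close>

lemma cinner_eq_inner:
  "cinner x y = Complex (inner x y) (inner (- \<i> *\<^sub>C x) (y :: 'a::complex_hilbert_space))"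
proof (rule complex_eqI)
  have "inner (- \<i> *\<^sub>C x) y = Re (- \<i> * cinner x y)"
    by (metis Re_cinner cinner_scaleC_left)
  then show "Im (cinner x y) = Im (Complex (inner x y) (inner (- \<i> *\<^sub>C x) y))" by simp
qed (simp add: Re_cinner)

lemma norm_scaleC: "norm (c *\<^sub>C x) = cmod c * norm (x :: 'a::complex_hilbert_space)"
proof -
  have "(norm (c *\<^sub>C x))\<^sup>2 = inner x ((cnj c * c) *\<^sub>C x)"
    by (simp add: power2_norm_eq_inner inner_scaleC_left scaleC_scaleC)
  also have "cnj c * c = complex_of_real ((cmod c)\<^sup>2)"
    by (metis complex_norm_square mult.commute)
  also have "inner x (\<dots> *\<^sub>C x) = (cmod c * norm x)\<^sup>2"
    by (simp only: scaleC_of_real) (simp add: power_mult_distrib power2_norm_eq_inner)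
  finally show ?thesis by (simp add: power2_eq_iff_nonneg)
qed

lemma bounded_linear_scaleC: "bounded_linear (\<lambda>x :: 'a::complex_hilbert_space. c *\<^sub>C x)"
  by (rule bounded_linear_intro[where K = "cmod c"])
    (simp_all add: scaleC_add_right scaleC_scaleR norm_scaleC)

lemma bounded_clinear_zero: "bounded_clinear (\<lambda>x. 0)"
  by (simp add: bounded_clinear_def scaleC_zero_right)

lemma bounded_clinear_add:
  "bounded_clinear S \<Longrightarrow> bounded_clinear T \<Longrightarrow> bounded_clinear (\<lambda>x. S x + T x)"
  by (simp add: bounded_clinear_def bounded_linear_add scaleC_add_right)

lemma bounded_clinear_diff:
  "bounded_clinear S \<Longrightarrow> bounded_clinear T \<Longrightarrow> bounded_clinear (\<lambda>x. S x - T x)"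
  by (simp add: bounded_clinear_def bounded_linear_sub scaleC_diff_right)

lemma bounded_clinear_scaleR: "bounded_clinear T \<Longrightarrow> bounded_clinear (\<lambda>x. r *\<^sub>R T x)"
  by (auto simp add: bounded_clinear_def scaleC_scaleR intro: bounded_linear_const_scaleR)

lemma bounded_clinear_compose:
  "bounded_clinear S \<Longrightarrow> bounded_clinear T \<Longrightarrow> bounded_clinear (\<lambda>x. S (T x))"
  by (simp add: bounded_clinear_def bounded_linear_compose)

lemma bounded_clinear_ident: "bounded_clinear (\<lambda>x. x)"
  by (simp add: bounded_clinear_def)

lemma bounded_clinear_intro:
  assumes "\<And>x y. T (x + y) = T x + T y" "\<And>c x. T (c *\<^sub>C x) = c *\<^sub>C T x"
    "\<And>x. norm (T x) \<le> K * norm x"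
  shows "bounded_clinear T"
  unfolding bounded_clinear_def
  using assms by (auto intro!: bounded_linear_intro[where K = K] simp: mult.commute simp flip: scaleC_of_real)

lemma bounded_clinear_limit:
  assumes "\<And>n. bounded_clinear (S n)" "\<And>x. (\<lambda>n. S n x) \<longlonglongrightarrow> L x"
    and "\<And>n x. norm (S n x) \<le> K * norm x"
  shows "bounded_clinear L"
proof (rule bounded_clinear_intro)
  fix x y c
  show "L (x + y) = L x + L y"
    using tendsto_add[OF assms(2)[of x] assms(2)[of y]] assms(2)[of "x + y"]
    by (simp add: bounded_clinear_simps[OF assms(1)] LIMSEQ_unique)
  show "L (c *\<^sub>C x) = c *\<^sub>C L x"
    using bounded_linear.tendsto[OF bounded_linear_scaleC assms(2)[of x], of c] assms(2)[of "c *\<^sub>C x"]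
    by (simp add: bounded_clinear_scaleC[OF assms(1)] LIMSEQ_unique)
  show "norm (L x) \<le> K * norm x"
    using assms(3) by (intro Lim_bounded[OF tendsto_norm[OF assms(2)]]) auto
qed

text \<open>A relational form of the adjoint that avoids the definite description in
  \<open>cadjoint\<close>; \<open>adjoint_pair A A\<close> expresses self-adjointness. The real
  inner product suffices because the operators are complex linear, see
  \<open>cadjoint_eq_iff\<close>.\<close>

definition adjoint_pair :: "('a::complex_hilbert_space \<Rightarrow> 'a) \<Rightarrow> ('a \<Rightarrow> 'a) \<Rightarrow> bool"
  where "adjoint_pair T S \<longleftrightarrow> bounded_clinear T \<and> bounded_clinear S \<and>
    (\<forall>x y. inner (T x) y = inner x (S y))"

lemma adjoint_pair_sym: "adjoint_pair T S \<Longrightarrow> adjoint_pair S T"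
  by (metis adjoint_pair_def inner_commute)

lemma cadjoint_eq_iff:
  assumes T: "bounded_clinear T" and S: "bounded_clinear S"
  shows "(\<forall>x y. cinner (T x) y = cinner x (S y)) \<longleftrightarrow> (\<forall>x y. inner (T x) y = inner x (S y))"
  by (auto simp: cinner_eq_inner simp flip: bounded_clinear_scaleC[OF T])

lemma cadjoint_eqI:
  assumes "adjoint_pair T S"
  shows "cadjoint T = S"
  unfolding cadjoint_def
proof (rule the_equality)
  show "bounded_clinear S \<and> (\<forall>x y. cinner (T x) y = cinner x (S y))"
    using assms by (simp add: adjoint_pair_def cadjoint_eq_iff)
next
  fix R assume "bounded_clinear R \<and> (\<forall>x y. cinner (T x) y = cinner x (R y))"
  then have "inner x (R y) = inner x (S y)" for x y
    using assms by (metis adjoint_pair_def cadjoint_eq_iff)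
  then show "R = S" by (auto simp: fun_eq_iff intro: vector_eq_ldot[THEN iffD1])
qed

text \<open>Riesz representation gives the value at each \<open>y\<close>; linearity follows because
  a vector is determined by its inner products, and boundedness from applying Cauchy-Schwarz to
  \<open>inner (T (S x)) x\<close>.\<close>

lemma adjoint_pair_cadjoint:
  assumes T: "bounded_clinear T"
  shows "adjoint_pair T (cadjoint T)"
proof -
  have bl: "bounded_linear T" using T by (rule bounded_clinear_bounded_linear)
  have "\<exists>z. \<forall>x. inner (T x) y = inner x z" for y
    using riesz_representation[OF bounded_linear_compose[OF bounded_linear_inner_left bl]] by metis
  then obtain S where S: "\<And>x y. inner (T x) y = inner x (S y)" by metis
  have eqI: "S y = z" if "\<And>x. inner x (S y) = inner x z" for y z
    using that by (rule vector_eq_ldot[THEN iffD1, OF allI])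
  obtain K where K: "\<And>x. norm (T x) \<le> norm x * K" "0 \<le> K"
    using bounded_linear.nonneg_bounded[OF bl] by metis
  have "bounded_clinear S"
  proof (rule bounded_clinear_intro)
    show "S (x + y) = S x + S y" for x y
      by (rule eqI) (simp add: inner_add_right flip: S)
    show "S (c *\<^sub>C x) = c *\<^sub>C S x" for c x
      by (rule eqI, subst inner_commute)
        (metis S T bounded_clinear_scaleC complex_cnj_cnj inner_commute inner_scaleC_left)
    show "norm (S x) \<le> K * norm x" for x
    proof (cases "S x = 0")
      case False
      have "norm (S x) * norm (S x) = inner (T (S x)) x"
        by (simp add: S flip: power2_norm_eq_inner power2_eq_square)
      also have "\<dots> \<le> norm (T (S x)) * norm x" by (rule norm_cauchy_schwarz)
      also have "\<dots> \<le> norm (S x) * K * norm x" by (intro mult_right_mono K) simp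
      finally show ?thesis using False by (simp add: mult.assoc)
    qed (simp add: K)
  qed
  then have "adjoint_pair T S" using S T by (simp add: adjoint_pair_def)
  then show ?thesis using cadjoint_eqI by metis
qed

lemma adjoint_pairD:
  assumes "adjoint_pair T S"
  shows "bounded_clinear T" "bounded_clinear S" "inner (T x) y = inner x (S y)"
    "inner (S x) y = inner x (T y)"
  using assms adjoint_pair_sym[OF assms] by (auto simp: adjoint_pair_def)

lemma adjoint_pair_zero: "adjoint_pair (\<lambda>x. 0) (\<lambda>x. 0)"
  by (simp add: adjoint_pair_def bounded_clinear_zero)

lemma adjoint_pair_ident: "adjoint_pair (\<lambda>x. x) (\<lambda>x. x)"
  by (simp add: adjoint_pair_def bounded_clinear_ident)

lemma adjoint_pair_add:
  "adjoint_pair T T' \<Longrightarrow> adjoint_pair S S' \<Longrightarrow> adjoint_pair (\<lambda>x. T x + S x) (\<lambda>x. T' x + S' x)"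
  by (simp add: adjoint_pair_def bounded_clinear_add inner_add_left inner_add_right)

lemma adjoint_pair_diff:
  "adjoint_pair T T' \<Longrightarrow> adjoint_pair S S' \<Longrightarrow> adjoint_pair (\<lambda>x. T x - S x) (\<lambda>x. T' x - S' x)"
  by (simp add: adjoint_pair_def bounded_clinear_diff inner_diff_left inner_diff_right)

lemma adjoint_pair_scaleR:
  "adjoint_pair T T' \<Longrightarrow> adjoint_pair (\<lambda>x. r *\<^sub>R T x) (\<lambda>x. r *\<^sub>R T' x)"
  by (simp add: adjoint_pair_def bounded_clinear_scaleR)

lemma adjoint_pair_compose:
  "adjoint_pair T T' \<Longrightarrow> adjoint_pair S S' \<Longrightarrow> adjoint_pair (\<lambda>x. T (S x)) (\<lambda>x. S' (T' x))"
  by (simp add: adjoint_pair_def bounded_clinear_compose)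

lemma adjoint_pair_limit:
  assumes "\<And>n. adjoint_pair (S n) (S n)" "\<And>x. (\<lambda>n. S n x) \<longlonglongrightarrow> L x"
    and "\<And>n x. norm (S n x) \<le> K * norm x"
  shows "adjoint_pair L L"
  unfolding adjoint_pair_def
proof (intro conjI allI)
  show "bounded_clinear L" "bounded_clinear L"
    using assms by (auto intro!: bounded_clinear_limit[of S L K] simp: adjoint_pair_def)
  show "inner (L x) y = inner x (L y)" for x y
    using tendsto_inner[OF assms(2)[of x] tendsto_const[of y]]
      tendsto_inner[OF tendsto_const[of x] assms(2)[of y]]
    by (simp add: adjoint_pairD(3)[OF assms(1)] LIMSEQ_unique)
qed

text \<open>Over the complex numbers, reality of the quadratic form forces self-adjointness:
  the real bilinear form \<open>inner (\<i> A x) y\<close> is alternating.\<close>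

lemma self_adjoint_if_quadratic_form_real:
  assumes A: "bounded_clinear A" and real: "\<And>x. cinner (A x) x \<in> \<real>"
  shows "adjoint_pair A A"
proof -
  have alt: "inner (\<i> *\<^sub>C A x) x = 0" for x
  proof -
    have "Im (cinner (A x) x) = 0" using real by (simp add: complex_is_Real_iff)
    then have "inner (A x) (\<i> *\<^sub>C x) = 0" by (simp add: cinner_eq_inner inner_scaleC_left)
    moreover have "(- 1) *\<^sub>R (\<i> *\<^sub>C x) = - \<i> *\<^sub>C x"
      by (simp only: scaleC_of_real[symmetric] scaleC_scaleC) simp
    ultimately show ?thesis by (simp add: inner_scaleC_left) (metis inner_minus_right neg_0_equal_iff_equal)
  qed
  have anti: "inner (\<i> *\<^sub>C A x) y = - inner (\<i> *\<^sub>C A y) x" for x y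
    using alt[of "x + y"] alt[of x] alt[of y]
    by (simp add: bounded_clinear_simps[OF A] scaleC_add_right inner_add_left inner_add_right)
  have "inner (A x) y = inner x (A y)" for x y
  proof -
    define z where "z = - \<i> *\<^sub>C x"
    have xz: "x = \<i> *\<^sub>C z" using scaleC_of_real[of 1 x] by (simp add: z_def scaleC_scaleC)
    have "inner (A x) y = inner (\<i> *\<^sub>C A z) y" by (simp add: xz bounded_clinear_scaleC[OF A])
    also have "\<dots> = - inner (A y) (- \<i> *\<^sub>C z)" by (subst anti) (simp add: inner_scaleC_left)
    also have "- \<i> *\<^sub>C z = (- 1) *\<^sub>R x"
      by (simp only: xz scaleC_of_real[symmetric] scaleC_scaleC) simp
    finally show ?thesis by (simp add: inner_commute)
  qed
  then show ?thesis using A by (simp add: adjoint_pair_def)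
qed

lemma adjoint_pair_cinner_self:
  assumes "adjoint_pair A A"
  shows "cinner (A x) x = complex_of_real (inner (A x) x)"
proof -
  have "cinner (A x) x = cinner x (A x)"
    using assms cadjoint_eq_iff[of A A] by (simp add: adjoint_pair_def)
  then have "cnj (cinner (A x) x) = cinner (A x) x" by (metis cinner_commute)
  then show ?thesis by (metis Re_cinner Reals_cnj_iff of_real_Re)
qed

section \<open>Positive operators\<close>

definition pos_op :: "('a::complex_hilbert_space \<Rightarrow> 'a) \<Rightarrow> bool"
  where "pos_op A \<longleftrightarrow> adjoint_pair A A \<and> (\<forall>x. 0 \<le> inner (A x) x)"

lemma pos_opD:
  assumes "pos_op A"
  shows "bounded_clinear A" "adjoint_pair A A" "inner (A x) y = inner x (A y)" "0 \<le> inner (A x) x"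
  using assms by (auto simp: pos_op_def adjoint_pair_def)

text \<open>Links \<open>pos_op\<close> to the conditions in \<open>op_sqrt\<close>: a quadratic
  form with nonnegative values is real, which forces self-adjointness.\<close>

lemma pos_op_iff: "pos_op A \<longleftrightarrow> bounded_clinear A \<and> op_le (\<lambda>x. 0) A"
proof
  assume "pos_op A"
  then show "bounded_clinear A \<and> op_le (\<lambda>x. 0) A"
    by (auto simp: op_le_def pos_op_def adjoint_pair_cinner_self dest: adjoint_pairD(1))
next
  assume A: "bounded_clinear A \<and> op_le (\<lambda>x. 0) A"
  then have "cinner (A x) x \<in> \<real>" for x
    using nonneg_Reals_subset_Reals by (force simp: op_le_def)
  then have "adjoint_pair A A" using A by (intro self_adjoint_if_quadratic_form_real) auto
  moreover have "0 \<le> inner (A x) x" for x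
    using A by (simp add: op_le_def complex_nonneg_Reals_iff Re_cinner)
  ultimately show "pos_op A" by (simp add: pos_op_def)
qed

lemma op_le_iff:
  assumes "adjoint_pair A A" "adjoint_pair B B"
  shows "op_le A B \<longleftrightarrow> (\<forall>x. inner (A x) x \<le> inner (B x) x)"
  by (simp add: op_le_def adjoint_pair_cinner_self[OF adjoint_pair_diff[OF assms(2,1)]]
      inner_diff_left del: of_real_diff)

lemma pos_op_diff:
  assumes "adjoint_pair A A" "adjoint_pair B B" "\<And>x. inner (A x) x \<le> inner (B x) x"
  shows "pos_op (\<lambda>x. B x - A x)"
  using assms by (simp add: pos_op_def adjoint_pair_diff inner_diff_left)

lemma pos_op_add: "pos_op A \<Longrightarrow> pos_op B \<Longrightarrow> pos_op (\<lambda>x. A x + B x)"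
  by (simp add: pos_op_def adjoint_pair_add inner_add_left)

lemma pos_op_scaleR: "pos_op A \<Longrightarrow> 0 \<le> r \<Longrightarrow> pos_op (\<lambda>x. r *\<^sub>R A x)"
  by (simp add: pos_op_def adjoint_pair_scaleR)

lemma pos_op_conjugate:
  assumes "pos_op A" "adjoint_pair T S"
  shows "pos_op (\<lambda>x. S (A (T x)))"
  using adjoint_pair_compose[OF adjoint_pair_sym[OF assms(2)]
      adjoint_pair_compose[OF pos_opD(2)[OF assms(1)] assms(2)]] assms
  by (simp add: pos_op_def adjoint_pairD(4)[OF assms(2)])

lemma pos_op_cauchy_schwarz:
  assumes A: "pos_op A"
  shows "(inner (A x) y)\<^sup>2 \<le> inner (A x) x * inner (A y) y"
proof -
  let ?a = "inner (A x) x" and ?b = "inner (A x) y" and ?c = "inner (A y) y"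
  have quad: "0 \<le> ?a + 2 * t * ?b + t\<^sup>2 * ?c" for t
  proof -
    have "inner (A (x + t *\<^sub>R y)) (x + t *\<^sub>R y) = ?a + 2 * t * ?b + t\<^sup>2 * ?c"
      using pos_opD(3)[OF A, of y x]
      by (simp add: bounded_clinear_simps[OF pos_opD(1)[OF A]] inner_add_left inner_add_right
          power2_eq_square inner_commute algebra_simps)
    then show ?thesis using pos_opD(4)[OF A] by metis
  qed
  have a: "0 \<le> ?a" and c: "0 \<le> ?c" using pos_opD(4)[OF A] by auto
  show ?thesis
  proof (cases "?c = 0")
    case True
    have "?b = 0"
    proof (rule ccontr)
      assume b: "?b \<noteq> 0"
      \<comment> \<open>With \<open>?c = 0\<close> the polynomial is affine, and at this
        \<open>t\<close> it equals -1.\<close>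
      show False using quad[of "- (?a + 1) / (2 * ?b)"] True b by (simp add: field_simps)
    qed
    then show ?thesis using True by simp
  next
    case False
    then have "0 \<le> ?a - ?b\<^sup>2 / ?c"
      using quad[of "- ?b / ?c"] by (simp add: power2_eq_square field_simps)
    then show ?thesis using c False by (simp add: field_simps)
  qed
qed

lemma pos_op_eq_zero_if_form_zero:
  assumes A: "pos_op A" and "inner (A x) x = 0"
  shows "A x = 0"
  using pos_op_cauchy_schwarz[OF A, of x "A x"] assms(2) by simp

text \<open>Cauchy-Schwarz for the form of \<open>A\<close> with \<open>y = A x\<close>, followed by
  the bound \<open>K\<close> at the vector \<open>A x\<close>. This turns control of quadratic forms
  into control of norms, which drives the monotone convergence below.\<close>

lemma pos_op_norm_square_le:
  assumes A: "pos_op A" and K: "\<And>x. inner (A x) x \<le> K * (norm x)\<^sup>2"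
  shows "(norm (A x))\<^sup>2 \<le> K * inner (A x) x"
proof (cases "A x = 0")
  case False
  have "((norm (A x))\<^sup>2)\<^sup>2 \<le> inner (A x) x * inner (A (A x)) (A x)"
    using pos_op_cauchy_schwarz[OF A, of x "A x"] by (simp add: power2_norm_eq_inner)
  also have "\<dots> \<le> inner (A x) x * (K * (norm (A x))\<^sup>2)"
    by (intro mult_left_mono K pos_opD(4)[OF A])
  finally show ?thesis using False by (simp add: power2_eq_square mult.commute)
qed simp

lemma pos_op_norm_le:
  assumes A: "pos_op A" and K: "\<And>x. inner (A x) x \<le> K * (norm x)\<^sup>2" and K0: "0 \<le> K"
  shows "norm (A x) \<le> K * norm x"
proof -
  have "(norm (A x))\<^sup>2 \<le> K * inner (A x) x" by (rule pos_op_norm_square_le[OF A K])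
  also have "\<dots> \<le> K * (K * (norm x)\<^sup>2)" by (intro mult_left_mono K K0)
  also have "\<dots> = (K * norm x)\<^sup>2" by (simp add: power2_eq_square)
  finally show ?thesis using K0 by (simp add: power2_le_iff_abs_le)
qed

section \<open>Positive square roots\<close>

text \<open>The iteration \<open>Y \<mapsto> (B + Y\<^sup>2) / 2\<close> started at \<open>0\<close> tends to \<open>I - (I - B)\<^sup>1\<^sup>/\<^sup>2\<close>.
  For a contraction \<open>B\<close> its increments are dominated in norm by those of the same iteration
  for the scalar \<open>1\<close>, which is bounded by \<open>1\<close>.\<close>

primrec sqrt_iter :: "('a::complex_hilbert_space \<Rightarrow> 'a) \<Rightarrow> nat \<Rightarrow> 'a \<Rightarrow> 'a" where
  "sqrt_iter B 0 = (\<lambda>x. 0)"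
| "sqrt_iter B (Suc n) = (\<lambda>x. (1/2) *\<^sub>R (B x + sqrt_iter B n (sqrt_iter B n x)))"

primrec sqrt_bound :: "nat \<Rightarrow> real" where
  "sqrt_bound 0 = 0"
| "sqrt_bound (Suc n) = (1 + (sqrt_bound n)\<^sup>2) / 2"

lemma sqrt_bound_range: "0 \<le> sqrt_bound n \<and> sqrt_bound n \<le> 1"
proof (induction n)
  case (Suc n)
  then have "(sqrt_bound n)\<^sup>2 \<le> 1" by (simp add: power_le_one)
  then show ?case by simp
qed simp

lemma sqrt_bound_mono: "sqrt_bound n \<le> sqrt_bound (Suc n)"
  using zero_le_power2[of "sqrt_bound n - 1"] by (simp add: power2_diff)

lemma sqrt_iter_properties:
  assumes "adjoint_pair B B" "\<And>x. norm (B x) \<le> norm x"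
  shows "adjoint_pair (sqrt_iter B n) (sqrt_iter B n)"
    and "norm (sqrt_iter B n x) \<le> sqrt_bound n * norm x"
    and "norm (sqrt_iter B (Suc n) x - sqrt_iter B n x) \<le> (sqrt_bound (Suc n) - sqrt_bound n) * norm x"
proof -
  show adj: "adjoint_pair (sqrt_iter B n) (sqrt_iter B n)" for n
  proof (induction n)
    case (Suc n)
    show ?case unfolding sqrt_iter.simps
      by (intro adjoint_pair_scaleR adjoint_pair_add[OF assms(1) adjoint_pair_compose[OF Suc Suc]])
  qed (simp add: adjoint_pair_zero)
  show bound: "norm (sqrt_iter B n x) \<le> sqrt_bound n * norm x" for n x
  proof (induction n arbitrary: x)
    case (Suc n)
    let ?Y = "sqrt_iter B n" and ?s = "sqrt_bound n"
    have "norm (?Y (?Y x)) \<le> ?s * norm (?Y x)" by (rule Suc)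
    also have "\<dots> \<le> ?s * (?s * norm x)" using sqrt_bound_range by (intro mult_left_mono Suc) auto
    finally have "norm (B x + ?Y (?Y x)) \<le> norm x + ?s * (?s * norm x)"
      using norm_triangle_ineq[of "B x" "?Y (?Y x)"] assms(2)[of x] by linarith
    then show ?case by (simp add: power2_eq_square distrib_right mult.assoc)
  qed simp
  show "norm (sqrt_iter B (Suc n) x - sqrt_iter B n x) \<le> (sqrt_bound (Suc n) - sqrt_bound n) * norm x"
  proof (induction n arbitrary: x)
    case 0
    then show ?case using assms(2)[of x] by simp
  next
    case (Suc n)
    let ?Y = "sqrt_iter B n" and ?s = "sqrt_bound n"
    let ?Z = "sqrt_iter B (Suc n)" and ?t = "sqrt_bound (Suc n)"
    have st: "0 \<le> ?t" "?s \<le> ?t" using sqrt_bound_range[of "Suc n"] sqrt_bound_mono[of n] by auto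
    have "norm (?Z (?Z x - ?Y x)) \<le> ?t * norm (?Z x - ?Y x)" by (rule bound)
    also have "\<dots> \<le> ?t * ((?t - ?s) * norm x)" by (intro mult_left_mono Suc st)
    finally have 1: "norm (?Z (?Z x - ?Y x)) \<le> ?t * (?t - ?s) * norm x" by (simp add: mult.assoc)
    have "norm (?Z (?Y x) - ?Y (?Y x)) \<le> (?t - ?s) * norm (?Y x)" by (rule Suc)
    also have "\<dots> \<le> (?t - ?s) * (?s * norm x)" by (intro mult_left_mono bound) (use st in simp)
    finally have 2: "norm (?Z (?Y x) - ?Y (?Y x)) \<le> (?t - ?s) * ?s * norm x" by (simp add: mult.assoc)
    have "sqrt_iter B (Suc (Suc n)) x - ?Z x = (1/2) *\<^sub>R (?Z (?Z x) - ?Y (?Y x))"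
      unfolding sqrt_iter.simps(2)[of B "Suc n"] sqrt_iter.simps(2)[of B n]
      by (simp add: algebra_simps)
    \<comment> \<open>This splitting needs no commutation of \<open>?Z\<close> and
      \<open>?Y\<close>; its scalar counterpart is \<open>t * (t - s) + (t - s) * s\<close>, the
      difference of the squares.\<close>
    also have "?Z (?Z x) - ?Y (?Y x) = ?Z (?Z x - ?Y x) + (?Z (?Y x) - ?Y (?Y x))"
      by (simp only: bounded_clinear_simps[OF adjoint_pairD(1)[OF adj]]) simp
    also have "norm ((1/2) *\<^sub>R (?Z (?Z x - ?Y x) + (?Z (?Y x) - ?Y (?Y x))))
        \<le> (1/2) * (?t * (?t - ?s) * norm x + (?t - ?s) * ?s * norm x)"
      using norm_triangle_ineq[of "?Z (?Z x - ?Y x)" "?Z (?Y x) - ?Y (?Y x)"] 1 2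
      by (simp del: sqrt_iter.simps sqrt_bound.simps)
    also have "\<dots> = ((1 + ?t\<^sup>2) / 2 - (1 + ?s\<^sup>2) / 2) * norm x"
      by (simp add: power2_eq_square algebra_simps del: sqrt_bound.simps)
    finally show ?case by (simp only: sqrt_bound.simps(2))
  qed
qed

text \<open>The increments telescope against the convergent scalar sequence
  \<open>sqrt_bound\<close>, so the iterates converge strongly. Whatever commutes with
  \<open>B\<close> commutes with every iterate, hence with the limit.\<close>

lemma sqrt_fixed_point_exists:
  assumes "adjoint_pair B B" "\<And>x. norm (B x) \<le> norm x"
  obtains Y where "adjoint_pair Y Y" "\<And>x. norm (Y x) \<le> norm x"
    "\<And>x. Y x = (1/2) *\<^sub>R (B x + Y (Y x))"
    "\<And>C x. bounded_clinear C \<Longrightarrow> (\<And>x. C (B x) = B (C x)) \<Longrightarrow> C (Y x) = Y (C x)"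
proof -
  let ?Y = "sqrt_iter B"
  note props = sqrt_iter_properties[OF assms]
  obtain l where l: "sqrt_bound \<longlonglongrightarrow> l"
    using incseq_convergent[of sqrt_bound 1] sqrt_bound_mono sqrt_bound_range
    by (metis incseq_SucI)
  have diff: "norm (?Y (n + k) x - ?Y n x) \<le> (sqrt_bound (n + k) - sqrt_bound n) * norm x" for n k x
  proof (induction k)
    case (Suc k)
    have "norm (?Y (n + Suc k) x - ?Y n x) \<le>
        norm (?Y (Suc (n + k)) x - ?Y (n + k) x) + norm (?Y (n + k) x - ?Y n x)"
      using norm_triangle_ineq[of "?Y (Suc (n + k)) x - ?Y (n + k) x" "?Y (n + k) x - ?Y n x"]
      by (simp del: sqrt_iter.simps)
    then show ?case using Suc props(3)[of "n + k" x] by (simp add: algebra_simps del: sqrt_iter.simps sqrt_bound.simps)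
  qed simp
  have "Cauchy (\<lambda>n. ?Y n x)" for x
  proof (rule CauchyI')
    fix e :: real assume e: "0 < e"
    have "Cauchy (\<lambda>n. sqrt_bound n * norm x)"
      by (intro LIMSEQ_imp_Cauchy[OF tendsto_mult[OF l tendsto_const]])
    then obtain M where M: "\<And>m n. m \<ge> M \<Longrightarrow> n \<ge> M \<Longrightarrow>
        norm (sqrt_bound m * norm x - sqrt_bound n * norm x) < e"
      using CauchyD e by blast
    have "norm (?Y m x - ?Y n x) < e" if "m \<ge> M" "n > m" for m n
    proof -
      have "norm (?Y m x - ?Y n x) \<le> sqrt_bound n * norm x - sqrt_bound m * norm x"
        using diff[of m "n - m" x] that by (simp add: norm_minus_commute left_diff_distrib)
      also have "\<dots> < e" using M[of n m] that by simp
      finally show ?thesis .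
    qed
    then show "\<exists>M. \<forall>m\<ge>M. \<forall>n>m. dist (?Y m x) (?Y n x) < e" by (auto simp: dist_norm)
  qed
  then have Y: "(\<lambda>n. ?Y n x) \<longlonglongrightarrow> lim (\<lambda>n. ?Y n x)" for x
    using Cauchy_convergent_iff convergent_LIMSEQ_iff by blast
  define Y where "Y x = lim (\<lambda>n. ?Y n x)" for x
  note Y = Y[folded Y_def]
  have bound: "norm (?Y n x) \<le> 1 * norm x" for n x
    using props(2)[of n x] sqrt_bound_range[of n] mult_right_mono[of "sqrt_bound n" 1 "norm x"] by auto
  have adj: "adjoint_pair Y Y" by (rule adjoint_pair_limit[OF props(1) Y bound])
  have comp: "(\<lambda>n. ?Y n (?Y n x)) \<longlonglongrightarrow> Y (Y x)" for x
  proof -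
    \<comment> \<open>The iterates are contractions, so replacing the inner \<open>?Y n x\<close> by
      its limit costs only a null sequence.\<close>
    have "(\<lambda>n. ?Y n (?Y n x - Y x)) \<longlonglongrightarrow> 0"
    proof (rule Lim_null_comparison)
      show "\<forall>\<^sub>F n in sequentially. norm (?Y n (?Y n x - Y x)) \<le> norm (?Y n x - Y x)"
        using bound by auto
      show "(\<lambda>n. norm (?Y n x - Y x)) \<longlonglongrightarrow> 0"
        using Y[of x] by (simp add: LIM_zero tendsto_norm_zero)
    qed
    from tendsto_add[OF this Y[of "Y x"]] show ?thesis
      by (simp add: bounded_clinear_simps[OF adjoint_pairD(1)[OF props(1)]])
  qed
  show thesis
  proof (rule that[of Y])
    show "adjoint_pair Y Y" by (rule adj)
    show "norm (Y x) \<le> norm x" for x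
      using bound by (intro Lim_bounded[OF tendsto_norm[OF Y]]) auto
    show "Y x = (1/2) *\<^sub>R (B x + Y (Y x))" for x
    proof (rule LIMSEQ_unique[OF LIMSEQ_Suc[OF Y]])
      show "(\<lambda>n. ?Y (Suc n) x) \<longlonglongrightarrow> (1/2) *\<^sub>R (B x + Y (Y x))"
        unfolding sqrt_iter.simps by (intro tendsto_intros comp)
    qed
    show "C (Y x) = Y (C x)" if C: "bounded_clinear C" and comm: "\<And>x. C (B x) = B (C x)" for C x
    proof -
      have "C (?Y n x) = ?Y n (C x)" for n x
        by (induction n arbitrary: x) (auto simp: bounded_clinear_simps[OF C] comm)
      then show ?thesis
        using bounded_linear.tendsto[OF bounded_clinear_bounded_linear[OF C] Y[of x]] Y[of "C x"]
        by (simp add: LIMSEQ_unique)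
    qed
  qed
qed

lemma pos_sqrt_exists:
  assumes A: "pos_op A"
  obtains R where "pos_op R" "R \<circ> R = A"
    "\<And>C x. bounded_clinear C \<Longrightarrow> (\<And>x. C (A x) = A (C x)) \<Longrightarrow> C (R x) = R (C x)"
proof -
  obtain K where K: "\<And>x. norm (A x) \<le> norm x * K" "0 < K"
    using bounded_linear.pos_bounded[OF bounded_clinear_bounded_linear[OF pos_opD(1)[OF A]]] by metis
  \<comment> \<open>Rescaling makes the form of \<open>A / K\<close> lie between 0 and that of the
    identity, so \<open>B\<close> is a positive contraction.\<close>
  define B where "B x = x - (1 / K) *\<^sub>R A x" for x
  have "inner (A x) x \<le> K * inner x x" for x
  proof -
    have "inner (A x) x \<le> norm (A x) * norm x" by (rule norm_cauchy_schwarz)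
    also have "\<dots> \<le> (norm x * K) * norm x" by (intro mult_right_mono K) simp
    finally show ?thesis by (simp add: power2_eq_square ac_simps flip: power2_norm_eq_inner)
  qed
  then have "pos_op B"
    unfolding B_def using K
    by (intro pos_op_diff adjoint_pair_ident adjoint_pair_scaleR pos_opD[OF A]) (simp add: field_simps)
  moreover have "inner (B x) x \<le> 1 * (norm x)\<^sup>2" for x
    using pos_opD(4)[OF A, of x] K by (simp add: B_def inner_diff_left power2_norm_eq_inner)
  ultimately have "norm (B x) \<le> norm x" "adjoint_pair B B" for x
    using pos_op_norm_le[of B 1 x] by (auto simp: pos_op_def)
  then obtain Y where Y: "adjoint_pair Y Y" "\<And>x. norm (Y x) \<le> norm x"
    and fp: "\<And>x. Y x = (1/2) *\<^sub>R (B x + Y (Y x))"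
    and comm: "\<And>C x. bounded_clinear C \<Longrightarrow> (\<And>x. C (B x) = B (C x)) \<Longrightarrow> C (Y x) = Y (C x)"
    using sqrt_fixed_point_exists[of B] by metis
  \<comment> \<open>The fixed point equation says that the square of \<open>I - Y\<close> is
    \<open>I - B\<close>, which is \<open>A / K\<close>.\<close>
  define R where "R x = sqrt K *\<^sub>R (x - Y x)" for x
  show thesis
  proof (rule that[of R])
    have "inner (Y x) x \<le> inner x x" for x
      using norm_cauchy_schwarz[of "Y x" x] mult_right_mono[OF Y(2)[of x] norm_ge_zero[of x]]
      by (simp add: power2_eq_square flip: power2_norm_eq_inner)
    then show "pos_op R"
      unfolding R_def using K by (intro pos_op_scaleR pos_op_diff adjoint_pair_ident Y) auto
    have "R (R x) = A x" for x
    proof -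
      have "R (R x) = K *\<^sub>R (x - 2 *\<^sub>R Y x + Y (Y x))"
        using K by (simp add: R_def bounded_clinear_simps[OF adjoint_pairD(1)[OF Y(1)]] algebra_simps
            scaleR_2)
      also have "2 *\<^sub>R Y x = B x + Y (Y x)" by (subst fp) simp
      finally show ?thesis using K by (simp add: B_def)
    qed
    then show "R \<circ> R = A" by auto
    show "C (R x) = R (C x)" if "bounded_clinear C" "\<And>x. C (A x) = A (C x)" for C x
      using comm[OF that(1), of x] that(2)
      by (simp add: B_def R_def bounded_clinear_simps[OF that(1)])
  qed
qed

lemma pos_sqrt_unique:
  assumes R: "pos_op R" and S: "pos_op S" and eq: "R \<circ> R = S \<circ> S"
    and comm: "\<And>x. S (R x) = R (S x)"
  shows "R = S"
proof
  fix x
  \<comment> \<open>For commuting roots \<open>(R + S) (R - S) = 0\<close>; positivity then makes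
    \<open>R\<close> and \<open>S\<close> vanish separately at \<open>y\<close>.\<close>
  define y where "y = R x - S x"
  note lin = bounded_clinear_simps[OF pos_opD(1)[OF R]] bounded_clinear_simps[OF pos_opD(1)[OF S]]
  have "R y + S y = 0"
    using fun_cong[OF eq, of x] by (simp add: y_def lin comm)
  then have "inner (R y) y + inner (S y) y = 0" by (simp flip: inner_add_left)
  then have "inner (R y) y = 0" "inner (S y) y = 0"
    using pos_opD(4)[OF R, of y] pos_opD(4)[OF S, of y] by linarith+
  then have "R y = 0" "S y = 0" using pos_op_eq_zero_if_form_zero R S by blast+
  moreover have "inner y y = inner x (R y) - inner x (S y)"
    by (subst (1) y_def) (simp add: inner_diff_left pos_opD(3)[OF R] pos_opD(3)[OF S])
  ultimately have "y = 0" by simp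
  then show "R x = S x" by (simp add: y_def)
qed

text \<open>Both roots commute with their common square, hence with the root \<open>Q\<close>
  constructed above, so each equals \<open>Q\<close> by the commuting case.\<close>

lemma pos_sqrt_eq:
  assumes R: "pos_op R" and S: "pos_op S" and eq: "R \<circ> R = S \<circ> S"
  shows "R = S"
proof -
  have A: "pos_op (S \<circ> S)"
    using pos_op_conjugate[OF _ pos_opD(2)[OF S], of "\<lambda>x. x"]
    by (simp add: comp_def pos_op_def adjoint_pair_ident)
  obtain Q where Q: "pos_op Q" "Q \<circ> Q = S \<circ> S"
    and comm: "\<And>C x. bounded_clinear C \<Longrightarrow> (\<And>x. C ((S \<circ> S) x) = (S \<circ> S) (C x)) \<Longrightarrow> C (Q x) = Q (C x)"
    using pos_sqrt_exists[OF A] by metis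
  have "R (Q x) = Q (R x)" for x
    by (rule comm[OF pos_opD(1)[OF R]]) (simp flip: eq)
  moreover have "S (Q x) = Q (S x)" for x
    by (rule comm[OF pos_opD(1)[OF S]]) simp
  ultimately show ?thesis
    using pos_sqrt_unique[OF Q(1) R] pos_sqrt_unique[OF Q(1) S] Q(2) eq by simp
qed

lemma op_sqrt_eqI:
  assumes "pos_op R" "R \<circ> R = A"
  shows "op_sqrt A = R"
  unfolding op_sqrt_def
proof (rule the_equality)
  show "bounded_clinear R \<and> op_le (\<lambda>x. 0) R \<and> R \<circ> R = A"
    using assms by (simp add: pos_op_iff)
  show "S = R" if "bounded_clinear S \<and> op_le (\<lambda>x. 0) S \<and> S \<circ> S = A" for S
    using that assms by (auto simp: pos_op_iff intro: pos_sqrt_eq)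
qed

lemma op_sqrt:
  assumes "pos_op A"
  shows "pos_op (op_sqrt A)" "op_sqrt A \<circ> op_sqrt A = A"
  using pos_sqrt_exists[OF assms] op_sqrt_eqI by metis+

section \<open>Polar decomposition\<close>

lemma adjoint_pair_norm_le:
  assumes VS: "adjoint_pair V S" and VSV: "\<And>x. V (S (V x)) = V x"
  shows "norm (V x) \<le> norm x"
proof -
  have "0 \<le> inner (x - S (V x)) (x - S (V x))" by simp
  also have "\<dots> = inner x x - inner (V x) (V x)"
    by (simp add: inner_diff_left inner_diff_right adjoint_pairD[OF VS] VSV)
  finally show ?thesis by (simp add: norm_eq_sqrt_inner)
qed

text \<open>Says that \<open>V A\<close> is a canonical polar decomposition and \<open>S = V\<^sup>*\<close>: the condition
  \<open>V S V = V\<close> characterises partial isometries, and the last two conditions give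
  \<open>\<N>(V) = \<N>(A)\<close>.\<close>

definition polar_factors ::
    "('a::complex_hilbert_space \<Rightarrow> 'a) \<Rightarrow> ('a \<Rightarrow> 'a) \<Rightarrow> ('a \<Rightarrow> 'a) \<Rightarrow> bool"
  where "polar_factors V S A \<longleftrightarrow> adjoint_pair V S \<and> pos_op A \<and>
    (\<forall>x. V (S (V x)) = V x) \<and> (\<forall>x. S (V (A x)) = A x) \<and> (\<forall>x. A x = 0 \<longrightarrow> V x = 0)"

text \<open>The last two facts are the adjoints of \<open>V S V = V\<close> and
  \<open>S V A = A\<close>.\<close>

lemma polar_factorsD:
  assumes "polar_factors V S A"
  shows "adjoint_pair V S" "pos_op A" "V (S (V x)) = V x" "S (V (A x)) = A x"
    "A x = 0 \<Longrightarrow> V x = 0" "S (V (S x)) = S x" "A (S (V x)) = A x"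
proof -
  show VS: "adjoint_pair V S" and A: "pos_op A" and VSV: "V (S (V x)) = V x"
    and SVA: "S (V (A x)) = A x" and "A x = 0 \<Longrightarrow> V x = 0" for x
    using assms by (auto simp: polar_factors_def)
  show "S (V (S x)) = S x"
  proof (rule vector_eq_ldot[THEN iffD1, OF allI])
    show "inner y (S (V (S x))) = inner y (S x)" for y
      by (metis adjoint_pairD(3)[OF VS] adjoint_pairD(4)[OF VS] VSV)
  qed
  show "A (S (V x)) = A x"
  proof (rule vector_eq_ldot[THEN iffD1, OF allI])
    show "inner y (A (S (V x))) = inner y (A x)" for y
      by (metis adjoint_pairD(3)[OF VS] adjoint_pairD(4)[OF VS] pos_opD(3)[OF A] SVA)
  qed
qed

lemma polar_factors_adjoint_pair:
  assumes "polar_factors V S A"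
  shows "adjoint_pair (V \<circ> A) (A \<circ> S)"
  using adjoint_pair_compose[OF polar_factorsD(1)[OF assms] pos_opD(2)[OF polar_factorsD(2)[OF assms]]]
  by (simp add: comp_def)

lemma polar_factors_norm:
  assumes "polar_factors V S A"
  shows "norm (V (A x)) = norm (A x)"
  by (simp add: norm_eq_sqrt_inner adjoint_pairD[OF polar_factorsD(1)[OF assms]]
      polar_factorsD[OF assms])

lemma polar_factors_op_abs:
  assumes "polar_factors V S A"
  shows "op_abs (V \<circ> A) = A"
  unfolding op_abs_def cadjoint_eqI[OF polar_factors_adjoint_pair[OF assms]]
  by (rule op_sqrt_eqI) (auto simp: polar_factorsD[OF assms])

text \<open>With \<open>T = V A\<close>, the square of \<open>V A S\<close> is
  \<open>V A A S\<close>, that is \<open>T\<close> times its adjoint, because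
  \<open>S V A = A\<close>.\<close>

lemma polar_factors_op_sqrt_adjoint:
  assumes "polar_factors V S A"
  shows "op_sqrt ((V \<circ> A) \<circ> cadjoint (V \<circ> A)) = (\<lambda>x. V (A (S x)))"
    and "pos_op (\<lambda>x. V (A (S x)))"
proof -
  show pos: "pos_op (\<lambda>x. V (A (S x)))"
    by (rule pos_op_conjugate[OF polar_factorsD(2)[OF assms] adjoint_pair_sym[OF polar_factorsD(1)[OF assms]]])
  show "op_sqrt ((V \<circ> A) \<circ> cadjoint (V \<circ> A)) = (\<lambda>x. V (A (S x)))"
    unfolding cadjoint_eqI[OF polar_factors_adjoint_pair[OF assms]]
    by (rule op_sqrt_eqI[OF pos]) (auto simp: polar_factorsD[OF assms])
qed

lemma semi_hyponormal_polar_iff: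
  assumes "polar_factors V S A"
  shows "semi_hyponormal (V \<circ> A) \<longleftrightarrow> (\<forall>x. inner (A (S x)) (S x) \<le> inner (A x) x)"
  using adjoint_pairD(1)[OF polar_factors_adjoint_pair[OF assms]]
    op_le_iff[OF pos_opD(2)[OF polar_factors_op_sqrt_adjoint(2)[OF assms]]
      pos_opD(2)[OF polar_factorsD(2)[OF assms]]]
  by (simp add: semi_hyponormal_def polar_factors_op_sqrt_adjoint(1)[OF assms]
      polar_factors_op_abs[OF assms, unfolded op_abs_def]
      adjoint_pairD(3)[OF polar_factorsD(1)[OF assms]])

lemma polar_factors_polar_isometry:
  assumes pf: "polar_factors V S A"
  shows "polar_isometry (V \<circ> A) = V"
  unfolding polar_isometry_def polar_factors_op_abs[OF pf]
proof (rule the_equality)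
  note VS = polar_factorsD(1)[OF pf] and A = polar_factorsD(2)[OF pf]
  note lin = bounded_clinear_simps[OF adjoint_pairD(1)[OF VS]] bounded_clinear_simps[OF pos_opD(1)[OF A]]
  have "norm (V x) = norm x" if x: "\<And>y. y \<in> null_space V \<Longrightarrow> cinner x y = 0" for x
  proof -
    \<comment> \<open>Orthogonality of \<open>x\<close> to this vector says exactly that
      \<open>x\<close> and \<open>V x\<close> have the same norm.\<close>
    have "x - S (V x) \<in> null_space V" by (simp add: null_space_def lin polar_factorsD[OF pf])
    from x[OF this] have "inner x (x - S (V x)) = 0" by (metis Re_cinner zero_complex.simps(1))
    then show ?thesis by (simp add: inner_diff_right norm_eq_sqrt_inner adjoint_pairD[OF VS])
  qed
  then have "partial_isometry V" using adjoint_pairD(1)[OF VS] by (simp add: partial_isometry_def)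
  moreover have "V (A x) = 0 \<longleftrightarrow> V x = 0" for x
    by (metis polar_factorsD(4,5,7)[OF pf] bounded_clinear_simps(3)[OF adjoint_pairD(2)[OF VS]] lin(3,8))
  ultimately show "partial_isometry V \<and> null_space V = null_space (V \<circ> A) \<and> V \<circ> A = V \<circ> A"
    by (simp add: null_space_def)
  fix U assume U: "partial_isometry U \<and> null_space U = null_space (V \<circ> A) \<and> V \<circ> A = U \<circ> A"
  then have blU: "bounded_linear U" and blV: "bounded_linear V"
    using adjoint_pairD(1)[OF VS] by (auto simp: partial_isometry_def bounded_clinear_def)
  have null: "U x = 0 \<and> V x = 0" if "A x = 0" for x
  proof -
    have "x \<in> null_space (V \<circ> A)" using that by (simp add: null_space_def lin)
    then have "x \<in> null_space U" using U by blast
    then show ?thesis using polar_factorsD(5)[OF pf that] by (simp add: null_space_def)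
  qed
  show "U = V"
  proof
    fix x
    \<comment> \<open>This closed subspace contains the range of \<open>A\<close>, so a vector
      orthogonal to it is killed by \<open>A\<close>, and there both \<open>U\<close> and
      \<open>V\<close> vanish.\<close>
    let ?M = "{y. U y = V y}"
    have "subspace ?M"
      by (auto simp: subspace_def linear_simps[OF blU] linear_simps[OF blV])
    moreover have "closed ?M"
      by (intro closed_Collect_eq linear_continuous_on blU blV)
    ultimately obtain m r where m: "x = m + r" "U m = V m" and r: "\<And>q. U q = V q \<Longrightarrow> inner r q = 0"
      using subspace_orthogonal_decomposition[of ?M x] by auto
    have "U (A y) = V (A y)" for y using U by (metis comp_apply)
    then have "inner (A r) (A r) = 0" using r by (simp add: pos_opD(3)[OF A])
    then show "U x = V x" using null[of r] m by (simp add: linear_simps[OF blU] linear_simps[OF blV])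
  qed
qed

lemma mean_transform_polar:
  assumes "polar_factors V S A"
  shows "mean_transform (V \<circ> A) = (\<lambda>x. (1/2) *\<^sub>R (V (A x) + A (V x)))"
  by (simp add: mean_transform_def polar_factors_op_abs[OF assms] polar_factors_polar_isometry[OF assms])

text \<open>On the closure of the range of \<open>A\<close> the operator \<open>V\<close> is given by the closure \<open>H\<close> of the
  relation between \<open>A u\<close> and \<open>T u\<close>; \<open>r\<close> is the component orthogonal to the range.\<close>

lemma bounded_factorization_exists:
  fixes T A :: "'a::complex_hilbert_space \<Rightarrow> 'a"
  assumes T: "bounded_clinear T" and A: "pos_op A" and norm: "\<And>x. norm (T x) = norm (A x)"
  obtains V where "bounded_clinear V" "\<And>x. V (A x) = T x" "\<And>x. A x = 0 \<Longrightarrow> V x = 0"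
proof -
  note linA = bounded_clinear_simps[OF pos_opD(1)[OF A]] and linT = bounded_clinear_simps[OF T]
  define H where "H x v \<longleftrightarrow> (\<exists>u r. (\<lambda>n. A (u n)) \<longlonglongrightarrow> x - r \<and> (\<lambda>n. T (u n)) \<longlonglongrightarrow> v \<and> A r = 0)"
    for x v
  have H_lin: "H (x + c *\<^sub>C y) (v + c *\<^sub>C w)" if "H x v" "H y w" for x v y w c
  proof -
    obtain u r where u: "(\<lambda>n. A (u n)) \<longlonglongrightarrow> x - r" "(\<lambda>n. T (u n)) \<longlonglongrightarrow> v" "A r = 0"
      using \<open>H x v\<close> H_def by blast
    obtain u' r' where u': "(\<lambda>n. A (u' n)) \<longlonglongrightarrow> y - r'" "(\<lambda>n. T (u' n)) \<longlonglongrightarrow> w" "A r' = 0"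
      using \<open>H y w\<close> H_def by blast
    note scale = bounded_linear.tendsto[OF bounded_linear_scaleC, of _ _ _ c]
    have "(\<lambda>n. A (u n + c *\<^sub>C u' n)) \<longlonglongrightarrow> (x + c *\<^sub>C y) - (r + c *\<^sub>C r')"
      using tendsto_add[OF u(1) scale[OF u'(1)]]
      by (simp add: linA bounded_clinear_scaleC[OF pos_opD(1)[OF A]] scaleC_diff_right algebra_simps)
    moreover have "(\<lambda>n. T (u n + c *\<^sub>C u' n)) \<longlonglongrightarrow> v + c *\<^sub>C w"
      using tendsto_add[OF u(2) scale[OF u'(2)]] by (simp add: linT bounded_clinear_scaleC[OF T])
    moreover have "A (r + c *\<^sub>C r') = 0"
      by (simp add: linA bounded_clinear_scaleC[OF pos_opD(1)[OF A]] u u' scaleC_zero_right)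
    ultimately show ?thesis unfolding H_def
      by (intro exI[of _ "\<lambda>n. u n + c *\<^sub>C u' n"] exI[of _ "r + c *\<^sub>C r'"]) simp
  qed
  have H_norm: "norm v \<le> norm x" if "H x v" for x v
  proof -
    obtain u r where u: "(\<lambda>n. A (u n)) \<longlonglongrightarrow> x - r" "(\<lambda>n. T (u n)) \<longlonglongrightarrow> v" "A r = 0"
      using \<open>H x v\<close> H_def by blast
    have "norm v = norm (x - r)"
      using tendsto_norm[OF u(1)] tendsto_norm[OF u(2)] by (simp add: norm LIMSEQ_unique)
    moreover have "inner (x - r) r = 0"
      using tendsto_inner[OF u(1) tendsto_const[of r]] by (simp add: pos_opD(3)[OF A] u(3) LIMSEQ_const_iff)
    then have "(norm x)\<^sup>2 = (norm (x - r))\<^sup>2 + (norm r)\<^sup>2"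
      by (simp add: power2_norm_eq_inner inner_diff_left inner_diff_right inner_commute)
    then have "(norm (x - r))\<^sup>2 \<le> (norm x)\<^sup>2" by simp
    ultimately show ?thesis by simp
  qed
  have H_unique: "v = w" if "H x v" "H x w" for x v w
  proof -
    have "H (x + complex_of_real (-1) *\<^sub>C x) (v + complex_of_real (-1) *\<^sub>C w)"
      using that by (rule H_lin)
    then have "H 0 (v - w)" by (simp only: scaleC_of_real) simp
    then show ?thesis using H_norm by force
  qed
  have H_exists: "\<exists>v. H x v" for x
  proof -
    let ?M = "closure (range A)"
    have "subspace (range A)"
      using bounded_clinear_bounded_linear[OF pos_opD(1)[OF A]]
      by (intro linear_subspace_image subspace_UNIV) (simp add: bounded_linear.linear)
    then have "subspace ?M" by (rule subspace_closure)
    then obtain p r where pr: "x = p + r" "p \<in> ?M" and r: "\<And>q. q \<in> ?M \<Longrightarrow> inner r q = 0"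
      using subspace_orthogonal_decomposition[of ?M x] by auto
    obtain a where a: "\<And>n. a n \<in> range A" "a \<longlonglongrightarrow> p"
      using pr(2) by (auto simp: closure_sequential)
    have "\<exists>w. a n = A w" for n using a(1)[of n] by blast
    then obtain u where u: "\<And>n. a n = A (u n)" by metis
    have "norm (T (u m) - T (u n)) = norm (a m - a n)" for m n
      using norm[of "u m - u n"] by (simp add: linA linT u)
    then have "Cauchy (\<lambda>n. T (u n))"
      using LIMSEQ_imp_Cauchy[OF a(2)] by (simp add: Cauchy_def dist_norm)
    then obtain v where "(\<lambda>n. T (u n)) \<longlonglongrightarrow> v"
      using Cauchy_convergent_iff convergent_def by blast
    moreover have "A (A r) \<in> ?M" using closure_subset[of "range A"] by blast
    then have "inner (A r) (A r) = 0" using r pos_opD(3)[OF A] by simp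
    moreover have "(\<lambda>n. A (u n)) \<longlonglongrightarrow> x - r" using a(2) pr(1) by (simp flip: u)
    ultimately show ?thesis unfolding H_def by auto
  qed
  define V where "V x = (THE v. H x v)" for x
  have HV: "H x (V x)" for x
    unfolding V_def using H_exists H_unique by (metis (mono_tags) theI)
  have V_eq: "V x = v" if "H x v" for x v using H_unique HV that by blast
  have "H (A x) (T x)" for x
    unfolding H_def by (intro exI[of _ "\<lambda>n. x"] exI[of _ 0]) (simp add: linA)
  moreover have "H x 0" if "A x = 0" for x
    unfolding H_def by (intro exI[of _ "\<lambda>n. 0"] exI[of _ x]) (simp add: linA linT that)
  moreover have "bounded_clinear V"
  proof (rule bounded_clinear_intro)
    have V_lin: "V (x + c *\<^sub>C y) = V x + c *\<^sub>C V y" for x y c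
      by (rule V_eq[OF H_lin[OF HV HV]])
    have V0: "V 0 = 0" using H_norm[OF HV, of 0] by simp
    show "V (x + y) = V x + V y" for x y
      using V_lin[of x "complex_of_real 1" y] by (simp only: scaleC_of_real) simp
    show "V (c *\<^sub>C x) = c *\<^sub>C V x" for c x using V_lin[of 0 c x] by (simp add: V0)
    show "norm (V x) \<le> 1 * norm x" for x using H_norm[OF HV] by simp
  qed
  ultimately show thesis using that V_eq by metis
qed

lemma polar_factors_exist:
  fixes T :: "'a::complex_hilbert_space \<Rightarrow> 'a"
  assumes T: "bounded_clinear T"
  obtains V S A where "polar_factors V S A" "T = V \<circ> A"
proof -
  note adj = adjoint_pair_cadjoint[OF T]
  have "adjoint_pair (cadjoint T \<circ> T) (cadjoint T \<circ> T)"
    using adjoint_pair_compose[OF adjoint_pair_sym[OF adj] adj] by (simp add: comp_def)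
  then have "pos_op (cadjoint T \<circ> T)"
    by (simp add: pos_op_def adjoint_pairD(4)[OF adj])
  then obtain A where A: "pos_op A" and AA: "A \<circ> A = cadjoint T \<circ> T"
    using op_sqrt by blast
  have inner: "inner (T x) (T y) = inner (A x) (A y)" for x y
    using fun_cong[OF AA, of y] by (simp add: adjoint_pairD(3)[OF adj] pos_opD(3)[OF A])
  then have "norm (T x) = norm (A x)" for x by (simp add: norm_eq_sqrt_inner)
  then obtain V where V: "bounded_clinear V" and VA: "\<And>x. V (A x) = T x"
    and null: "\<And>x. A x = 0 \<Longrightarrow> V x = 0"
    using bounded_factorization_exists[OF T A] by metis
  define S where "S = cadjoint V"
  have VS: "adjoint_pair V S" unfolding S_def by (rule adjoint_pair_cadjoint[OF V])
  note linA = bounded_clinear_simps[OF pos_opD(1)[OF A]]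
  have SVA: "S (V (A x)) = A x" for x
  proof -
    \<comment> \<open>The vector \<open>d\<close> is orthogonal to the range of \<open>A\<close>, so
      \<open>A d = 0\<close> and therefore \<open>V d = 0\<close>; these two facts make
      \<open>inner d d\<close> vanish.\<close>
    define d where "d = S (V (A x)) - A x"
    have "inner d (A y) = 0" for y
      by (simp add: d_def inner_diff_left adjoint_pairD[OF VS] VA inner)
    then have "inner (A d) (A d) = 0" by (simp add: pos_opD(3)[OF A])
    then have Ad: "A d = 0" by simp
    have "inner d d = inner (V (A x)) (V d) - inner x (A d)"
      by (subst (1) d_def) (simp add: inner_diff_left adjoint_pairD[OF VS] pos_opD(3)[OF A])
    also have "\<dots> = 0" using Ad null[OF Ad] by simp
    finally show ?thesis by (simp add: d_def)
  qed
  have "A (S (V x)) = A x" for x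
  proof (rule vector_eq_ldot[THEN iffD1, OF allI])
    show "inner y (A (S (V x))) = inner y (A x)" for y
      by (metis adjoint_pairD(3)[OF VS] adjoint_pairD(4)[OF VS] pos_opD(3)[OF A] SVA)
  qed
  \<comment> \<open>The argument of \<open>V\<close> lies in the kernel of \<open>A\<close>, hence
    in that of \<open>V\<close>; this yields \<open>V S V = V\<close>.\<close>
  then have "V (S (V x) - x) = 0" for x by (intro null) (simp add: linA)
  then have "polar_factors V S A"
    using VS A SVA null by (simp add: polar_factors_def bounded_clinear_simps[OF V])
  moreover have "T = V \<circ> A" using VA by auto
  ultimately show thesis by (rule that)
qed

section \<open>Monotone convergence and the mean transform\<close>

text \<open>For each \<open>x\<close> the forms increase and are bounded, so they are Cauchy.
  Differences of terms are positive with form bound \<open>K\<close>, so the squared norms of their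
  values are at most \<open>K\<close> times the form increments.\<close>

lemma pos_op_increasing_convergent:
  fixes A :: "nat \<Rightarrow> 'a::complex_hilbert_space \<Rightarrow> 'a"
  assumes A: "\<And>n. pos_op (A n)"
    and mono: "\<And>n x. inner (A n x) x \<le> inner (A (Suc n) x) x"
    and K: "\<And>n x. inner (A n x) x \<le> K * (norm x)\<^sup>2" "0 \<le> K"
  obtains L where "pos_op L" "\<And>x. (\<lambda>n. A n x) \<longlonglongrightarrow> L x"
    "\<And>n x. inner (A n x) x \<le> inner (L x) x"
proof -
  have mono': "inner (A m x) x \<le> inner (A n x) x" if "m \<le> n" for m n x
    using lift_Suc_mono_le[of "\<lambda>n. inner (A n x) x", OF mono that] .
  have diff: "(norm (A n x - A m x))\<^sup>2 \<le> K * (inner (A n x) x - inner (A m x) x)" if "m \<le> n" for m n x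
  proof -
    have "pos_op (\<lambda>x. A n x - A m x)"
      using that by (intro pos_op_diff pos_opD(2)[OF A] mono')
    moreover have "inner (A n x - A m x) x \<le> K * (norm x)\<^sup>2" for x
      using K(1)[of n x] pos_opD(4)[OF A, of m x] by (simp add: inner_diff_left)
    ultimately have "(norm (A n x - A m x))\<^sup>2 \<le> K * inner (A n x - A m x) x"
      by (rule pos_op_norm_square_le)
    then show ?thesis by (simp add: inner_diff_left)
  qed
  have form_conv: "convergent (\<lambda>n. inner (A n x) x)" for x
    using incseq_convergent[of "\<lambda>n. inner (A n x) x" "K * (norm x)\<^sup>2"] mono K(1)
    by (metis convergent_def incseq_SucI)
  have "Cauchy (\<lambda>n. A n x)" for x
  proof (rule CauchyI')
    fix e :: real assume e: "0 < e"
    have "Cauchy (\<lambda>n. K * inner (A n x) x)"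
      using form_conv[of x] by (intro convergent_Cauchy convergent_mult convergent_const)
    then obtain M where M: "\<And>m n. m \<ge> M \<Longrightarrow> n \<ge> M \<Longrightarrow>
        norm (K * inner (A m x) x - K * inner (A n x) x) < e\<^sup>2"
      using CauchyD[of "\<lambda>n. K * inner (A n x) x" "e\<^sup>2"] e by auto
    have "dist (A m x) (A n x) < e" if "m \<ge> M" "n > m" for m n
    proof -
      have "(norm (A n x - A m x))\<^sup>2 \<le> K * inner (A n x) x - K * inner (A m x) x"
        using diff[of m n x] that by (simp add: right_diff_distrib)
      also have "\<dots> < e\<^sup>2" using M[of n m] that by simp
      finally show ?thesis using e by (metis dist_norm norm_minus_commute power_less_imp_less_base less_imp_le)
    qed
    then show "\<exists>M. \<forall>m\<ge>M. \<forall>n>m. dist (A m x) (A n x) < e" by blast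
  qed
  then have lim: "(\<lambda>n. A n x) \<longlonglongrightarrow> lim (\<lambda>n. A n x)" for x
    using Cauchy_convergent_iff convergent_LIMSEQ_iff by blast
  define L where "L x = lim (\<lambda>n. A n x)" for x
  note lim = lim[folded L_def]
  have form_lim: "(\<lambda>n. inner (A n x) x) \<longlonglongrightarrow> inner (L x) x" for x
    by (intro tendsto_inner lim tendsto_const)
  have le: "inner (A n x) x \<le> inner (L x) x" for n x
    using incseq_le[OF incseq_SucI form_lim] mono by blast
  have "adjoint_pair L L"
    using pos_opD(2)[OF A] lim pos_op_norm_le[OF A K] by (rule adjoint_pair_limit)
  moreover have "0 \<le> inner (L x) x" for x
    using le[of 0 x] pos_opD(4)[OF A, of 0 x] by linarith
  ultimately show thesis using that[of L] lim le by (simp add: pos_op_def)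
qed

lemma pos_op_onorm_mono:
  assumes A: "pos_op A" and B: "pos_op B" and le: "\<And>x. inner (A x) x \<le> inner (B x) x"
  shows "onorm A \<le> onorm B"
proof (rule onorm_bound)
  have blB: "bounded_linear B" using pos_opD(1)[OF B] by (rule bounded_clinear_bounded_linear)
  show pos: "0 \<le> onorm B" by (rule onorm_pos_le[OF blB])
  have "inner (A x) x \<le> onorm B * (norm x)\<^sup>2" for x
  proof -
    have "inner (A x) x \<le> norm (B x) * norm x" using le norm_cauchy_schwarz order_trans by blast
    also have "\<dots> \<le> onorm B * norm x * norm x" by (intro mult_right_mono onorm[OF blB]) simp
    finally show ?thesis by (simp add: power2_eq_square mult.assoc)
  qed
  then show "norm (A x) \<le> onorm B * norm x" for x by (rule pos_op_norm_le[OF A _ pos])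
qed

text \<open>The mean transform replaces the factor \<open>A\<close> of \<open>T = V A\<close> by the following one and
  leaves \<open>V\<close> unchanged, provided that \<open>V\<close> is normal and \<open>V A V\<^sup>* \<le> A\<close>.\<close>

definition mean_factor ::
    "('a::complex_hilbert_space \<Rightarrow> 'a) \<Rightarrow> ('a \<Rightarrow> 'a) \<Rightarrow> ('a \<Rightarrow> 'a) \<Rightarrow> 'a \<Rightarrow> 'a"
  where "mean_factor V S A = (\<lambda>x. (1/2) *\<^sub>R (A x + S (A (V x))))"

text \<open>One induction step for the iterates: the polar structure, the semi-hyponormal inequality
  and the form bound pass from \<open>A\<close> to the next factor, while the forms do not
  decrease.\<close>

lemma mean_factor_step:
  assumes pf: "polar_factors V S A" and comm: "\<And>x. S (V x) = V (S x)"
    and le: "\<And>x. inner (A (S x)) (S x) \<le> inner (A x) x"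
  shows "polar_factors V S (mean_factor V S A)"
    and "mean_transform (V \<circ> A) = V \<circ> mean_factor V S A"
    and "inner (mean_factor V S A (S x)) (S x) \<le> inner (mean_factor V S A x) x"
    and "inner (A x) x \<le> inner (mean_factor V S A x) x"
    and "(\<And>x. inner (A x) x \<le> K * (norm x)\<^sup>2) \<Longrightarrow> 0 \<le> K \<Longrightarrow>
      inner (mean_factor V S A x) x \<le> K * (norm x)\<^sup>2"
proof -
  note D = polar_factorsD[OF pf]
  note lin = bounded_clinear_simps[OF adjoint_pairD(1)[OF D(1)]]
    bounded_clinear_simps[OF adjoint_pairD(2)[OF D(1)]]
  \<comment> \<open>Since \<open>S V = V S\<close>, the final projection also fixes the range of
    \<open>A\<close>. This turns \<open>V S A V\<close> into \<open>A V\<close>, so \<open>V\<close>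
    factors out of the mean transform.\<close>
  have VSA: "V (S (A x)) = A x" for x using D(4) comm by metis
  have AVS: "A (V (S x)) = A x" for x using D(7) comm by metis
  have form: "inner (mean_factor V S A x) x = (inner (A x) x + inner (A (V x)) (V x)) / 2" for x
    by (simp add: mean_factor_def inner_add_left adjoint_pairD(4)[OF D(1)])
  \<comment> \<open>This is the semi-hyponormal inequality at \<open>V x\<close>, rewritten with
    \<open>A S V = A\<close>.\<close>
  have step: "inner (A x) x \<le> inner (A (V x)) (V x)" for x
  proof -
    have "inner (A x) x = inner (A (S (V x))) (S (V x))"
      by (metis D(7) pos_opD(3)[OF D(2)] D(4) adjoint_pairD(3)[OF D(1)] adjoint_pairD(4)[OF D(1)])
    then show ?thesis using le[of "V x"] by simp
  qed
  have pos: "pos_op (mean_factor V S A)"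
    unfolding mean_factor_def by (intro pos_op_scaleR pos_op_add D(2) pos_op_conjugate[OF D(2,1)]) simp
  have "V x = 0" if "mean_factor V S A x = 0" for x
  proof -
    have "inner (A x) x + inner (A (V x)) (V x) = 0" using form[of x] that by simp
    then have "inner (A x) x = 0" using pos_opD(4)[OF D(2)] by (metis add_nonneg_eq_0_iff)
    then show ?thesis using pos_op_eq_zero_if_form_zero[OF D(2)] D(5) by blast
  qed
  then show "polar_factors V S (mean_factor V S A)"
    using D pos by (auto simp: polar_factors_def mean_factor_def lin)
  show "mean_transform (V \<circ> A) = V \<circ> mean_factor V S A"
    by (auto simp: mean_transform_polar[OF pf] mean_factor_def lin VSA)
  show "inner (A x) x \<le> inner (mean_factor V S A x) x" using step[of x] form[of x] by simp
  have "inner (A (V (S x))) (V (S x)) = inner (A x) x"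
    by (metis AVS VSA pos_opD(3)[OF D(2)] adjoint_pairD(3)[OF D(1)] adjoint_pairD(4)[OF D(1)])
  then show "inner (mean_factor V S A (S x)) (S x) \<le> inner (mean_factor V S A x) x"
    using le[of x] step[of x] by (simp add: form)
  assume K: "\<And>x. inner (A x) x \<le> K * (norm x)\<^sup>2" "0 \<le> K"
  have "norm (V x) \<le> norm x" using adjoint_pair_norm_le[OF D(1)] D(3) by blast
  then have "K * (norm (V x))\<^sup>2 \<le> K * (norm x)\<^sup>2" using K(2) by (intro mult_left_mono power_mono) auto
  then show "inner (mean_factor V S A x) x \<le> K * (norm x)\<^sup>2"
    using K(1)[of x] K(1)[of "V x"] form[of x] by argo
qed

text \<open>The kernels of \<open>V\<close> and \<open>S\<close> coincide, one inclusion coming from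
  the null space assumption and the other from the inequality on forms. Hence the initial projection
  \<open>S V\<close> and the final projection \<open>V S\<close> agree.\<close>

lemma polar_isometry_normal:
  assumes pf: "polar_factors V S A"
    and null: "null_space (cadjoint (V \<circ> A)) \<subseteq> null_space (V \<circ> A)"
    and le: "\<And>x. inner (A (S x)) (S x) \<le> inner (A x) x"
  shows "S (V x) = V (S x)"
proof -
  note D = polar_factorsD[OF pf]
  note linV = bounded_clinear_simps[OF adjoint_pairD(1)[OF D(1)]]
    and linS = bounded_clinear_simps[OF adjoint_pairD(2)[OF D(1)]]
    and linA = bounded_clinear_simps[OF pos_opD(1)[OF D(2)]]
  have adj: "cadjoint (V \<circ> A) = A \<circ> S"
    by (rule cadjoint_eqI[OF polar_factors_adjoint_pair[OF pf]])
  have SV: "V x = 0" if "S x = 0" for x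
  proof -
    have "x \<in> null_space (cadjoint (V \<circ> A))" using that by (simp add: adj null_space_def linA)
    then have "x \<in> null_space (V \<circ> A)" using null by blast
    then have "A x = 0" using polar_factors_norm[OF pf, of x] by (simp add: null_space_def)
    then show ?thesis by (rule D(5))
  qed
  have VS: "S x = 0" if "V x = 0" for x
  proof -
    have "A x = 0" using D(7)[of x] that by (simp add: linS linA)
    then have "inner (A (S x)) (S x) = 0"
      using le[of x] pos_opD(4)[OF D(2), of "S x"] by simp
    then have "V (S x) = 0" using pos_op_eq_zero_if_form_zero[OF D(2)] D(5) by blast
    then show ?thesis using D(6)[of x] by (simp add: linS)
  qed
  have 1: "S (S (V x)) = S x" for x using VS[of "S (V x) - x"] D(3) by (simp add: linV linS)
  have 2: "V (V (S x)) = V x" for x using SV[of "V (S x) - x"] D(6) by (simp add: linV linS)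
  \<comment> \<open>Taking adjoints in \<open>1\<close> and \<open>2\<close> gives
    \<open>S V V = V\<close> and \<open>V S S = S\<close>: each of the projections
    \<open>S V\<close> and \<open>V S\<close> fixes the range of the other.\<close>
  show ?thesis
  proof (rule vector_eq_ldot[THEN iffD1, OF allI])
    show "inner y (S (V x)) = inner y (V (S x))" for y
      by (metis 1 2 adjoint_pairD(3)[OF D(1)] adjoint_pairD(4)[OF D(1)])
  qed
qed

lemma polar_factors_onorm:
  assumes "polar_factors V S A"
  shows "onorm (V \<circ> A) = onorm A"
  by (simp add: onorm_def polar_factors_norm[OF assms])

theorem theorem2p17:
  fixes T :: "'a::complex_hilbert_space \<Rightarrow> 'a"
  assumes "bounded_clinear T"
    and "null_space (cadjoint T) \<subseteq> null_space T"
    and "semi_hyponormal T"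
  shows "semi_hyponormal (mean_transform T) \<and>
    (\<exists>L. bounded_clinear L \<and> normal_op L \<and>
      sot_tendsto (\<lambda>n. mean_iterate n T) L \<and>
      mean_limit T = onorm L \<and>
      (\<forall>n. onorm L = onorm (mean_iterate n T)))"
proof -
  obtain V S A where pf: "polar_factors V S A" and T: "T = V \<circ> A"
    using polar_factors_exist[OF assms(1)] by blast
  have le: "inner (A (S x)) (S x) \<le> inner (A x) x" for x
    using assms(3) semi_hyponormal_polar_iff[OF pf] T by simp
  have comm: "S (V x) = V (S x)" for x
    using polar_isometry_normal[OF pf assms(2)[unfolded T] le] .
  \<comment> \<open>Only the positive factor evolves; \<open>V\<close> stays the polar isometry of
    every iterate.\<close>
  define B where "B n = (mean_factor V S ^^ n) A" for n
  have B0: "B 0 = A" and BSuc: "B (Suc n) = mean_factor V S (B n)" for n by (auto simp: B_def)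
  have B: "polar_factors V S (B n) \<and> (\<forall>x. inner (B n (S x)) (S x) \<le> inner (B n x) x)" for n
  proof (induction n)
    case (Suc n)
    then show ?case
      using mean_factor_step(1,3)[where V = V and S = S and A = "B n"] comm by (simp add: BSuc)
  qed (simp add: B0 pf le)
  then have Bpf: "polar_factors V S (B n)" and Ble: "inner (B n (S x)) (S x) \<le> inner (B n x) x" for n x
    by auto
  note step = mean_factor_step[where V = V and S = S and A = "B n" for n, OF Bpf comm Ble, folded BSuc]
  have iter: "mean_iterate n T = V \<circ> B n" for n
    by (induction n) (simp_all add: mean_iterate_def T B0 comp_def step(2)[unfolded comp_def])
  define K where "K = onorm A"
  have blA: "bounded_linear A"
    by (rule bounded_clinear_bounded_linear[OF pos_opD(1)[OF polar_factorsD(2)[OF pf]]])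
  have K0: "0 \<le> K" unfolding K_def by (rule onorm_pos_le[OF blA])
  have BK: "inner (B n x) x \<le> K * (norm x)\<^sup>2" for n x
  proof (induction n arbitrary: x)
    case 0
    have "inner (A x) x \<le> norm (A x) * norm x" by (rule norm_cauchy_schwarz)
    also have "\<dots> \<le> K * norm x * norm x" unfolding K_def by (intro mult_right_mono onorm[OF blA]) simp
    finally show ?case by (simp add: B0 power2_eq_square mult.assoc)
  qed (use step(5) K0 in blast)
  note Bpos = polar_factorsD(2)[OF Bpf]
  obtain C where C: "pos_op C" and lim: "\<And>x. (\<lambda>n. B n x) \<longlonglongrightarrow> C x"
    and BC: "\<And>n x. inner (B n x) x \<le> inner (C x) x"
    using pos_op_increasing_convergent[of B K, OF Bpos step(4) BK K0] by blast
  note VS = polar_factorsD(1)[OF pf]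
  note limV = bounded_linear.tendsto[OF bounded_clinear_bounded_linear[OF adjoint_pairD(1)[OF VS]]]
    and limS = bounded_linear.tendsto[OF bounded_clinear_bounded_linear[OF adjoint_pairD(2)[OF VS]]]
  have SVC: "S (V (C x)) = C x" for x
    using limS[OF limV[OF lim[of x]]] lim[of x] by (simp add: polar_factorsD(4)[OF Bpf] LIMSEQ_unique)
  \<comment> \<open>Passing to the limit in the recursion for \<open>B\<close> shows that
    \<open>C\<close> is a fixed point of \<open>mean_factor V S\<close>, which is equivalent to
    \<open>C = S C V\<close>.\<close>
  have avg: "C x = (1/2) *\<^sub>R (C x + S (C (V x)))" for x
  proof (rule LIMSEQ_unique[OF LIMSEQ_Suc[OF lim]])
    show "(\<lambda>n. B (Suc n) x) \<longlonglongrightarrow> (1/2) *\<^sub>R (C x + S (C (V x)))"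
      unfolding BSuc mean_factor_def by (intro tendsto_intros lim limS)
  qed
  have SCV: "S (C (V x)) = C x" for x
  proof -
    have "2 *\<^sub>R C x = C x + S (C (V x))" by (subst (1) avg) simp
    then show ?thesis by (simp add: scaleR_2)
  qed
  have "polar_factors V S C"
    unfolding polar_factors_def
  proof (intro conjI allI impI)
    show "V x = 0" if "C x = 0" for x
    proof -
      \<comment> \<open>The kernel cannot grow in the limit, because the form of \<open>C\<close>
        dominates that of \<open>A\<close>.\<close>
      have "inner (A x) x = 0"
        using BC[of 0 x] pos_opD(4)[OF Bpos, of 0 x] that by (simp add: B0)
      then show ?thesis
        using pos_op_eq_zero_if_form_zero[OF polar_factorsD(2)[OF pf]] polar_factorsD(5)[OF pf] by blast
    qed
  qed (use C VS SVC polar_factorsD(3)[OF pf] in auto)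
  note Cpf = this
  define L where "L = V \<circ> C"
  have adj: "adjoint_pair L (C \<circ> S)" unfolding L_def by (rule polar_factors_adjoint_pair[OF Cpf])
  have "V (C x) = C (V x)" for x
  proof -
    have "V (C x) = V (S (C (V x)))" by (simp add: SCV)
    also have "\<dots> = C (V x)" using SVC comm by metis
    finally show ?thesis .
  qed
  \<comment> \<open>Both products reduce to \<open>C C\<close>, since \<open>V\<close> commutes with
    \<open>C\<close> and \<open>C S V = C\<close>.\<close>
  then have "(C \<circ> S) \<circ> L = L \<circ> (C \<circ> S)"
    using polar_factorsD(7)[OF Cpf] by (auto simp: L_def SVC SCV comm[symmetric] fun_eq_iff)
  then have normal: "normal_op L"
    using adjoint_pairD(1)[OF adj] by (simp add: normal_op_def cadjoint_eqI[OF adj])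
  \<comment> \<open>The bound \<open>K\<close> on the forms survives the limit, and
    \<open>A = B 0\<close> lies below \<open>C\<close>; the norm of \<open>C\<close> is therefore
    squeezed to that of \<open>A\<close>.\<close>
  have onL: "onorm L = K"
    unfolding L_def polar_factors_onorm[OF Cpf]
  proof (rule antisym)
    have "inner (C x) x \<le> K * (norm x)\<^sup>2" for x
      using tendsto_inner[OF lim[of x] tendsto_const[of x]] BK by (intro Lim_bounded) auto
    then show "onorm C \<le> K" using pos_op_norm_le[OF C _ K0] K0 by (intro onorm_bound) auto
    show "K \<le> onorm C"
      unfolding K_def using BC[of 0] by (intro pos_op_onorm_mono C polar_factorsD(2)[OF pf]) (simp add: B0)
  qed
  have on: "onorm (mean_iterate n T) = K" for n
    unfolding iter polar_factors_onorm[OF Bpf]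
  proof (rule antisym)
    show "onorm (B n) \<le> K" using pos_op_norm_le[OF Bpos BK K0] K0 by (intro onorm_bound) auto
    have "inner (A x) x \<le> inner (B n x) x" for x
      using lift_Suc_mono_le[of "\<lambda>n. inner (B n x) x" 0 n] step(4) by (simp add: B0)
    then show "K \<le> onorm (B n)"
      unfolding K_def by (intro pos_op_onorm_mono Bpos polar_factorsD(2)[OF pf])
  qed
  have "semi_hyponormal (mean_transform T)"
    using iter[of 1] semi_hyponormal_polar_iff[OF Bpf, of 1] Ble by (simp add: mean_iterate_def)
  moreover have "sot_tendsto (\<lambda>n. mean_iterate n T) L"
    unfolding sot_tendsto_def iter L_def using limV[OF lim] by simp
  moreover have "mean_limit T = onorm L" by (simp add: mean_limit_def on onL)
  ultimately show ?thesis using normal adjoint_pairD(1)[OF adj] on onL by auto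
qed

end
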